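(* Let $X,Y$ be infinite-dimensional Banach spaces. If $0<p,p^*<\infty$ and $p\neq p^*$, then $$\mathcal{L}^{(a)}_{p,q_1}(X,Y)\neq \mathcal{L}^{(a)}_{p^*,q_2}(X,Y)$$ for all $0<q_1,q_2<\infty$. Furthermore, for any given $p>0$, the spaces $\mathcal{L}^{(a)}_{p,r}(X,Y)$, $0<r<\infty$, either collapse (are all equal) or they are pairwise distinct.
   Context: $\mathcal{L}(X,Y)$ denotes the space of bounded linear operators $T:X\to Y$. For $T\in\mathcal{L}(X,Y)$, the $n$-th approximation number is $a_n(T)=\inf\{\|T-R\|: R\in\mathcal{L}(X,Y),\ \mathrm{rank}(R)<n\}$, $n=1,2,\dots$. For $0<p,q<\infty$, $$\mathcal{L}^{(a)}_{p,q}(X,Y)=\left\{T\in\mathcal{L}(X,Y):\ \|T\|_{p,q}=\left(\sum_{n=1}^\infty\left(n^{\frac1p-\frac1q}a_n(T)\right)^q\right)^{1/q}<\infty\right\}.$$ Equality of these spaces means equality as subsets of $\mathcal{L}(X,Y)$. *)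

theory Defs
  imports "HOL-Analysis.Analysis"
begin

text \<open>
  Banach spaces are taken over a scalar field that is either the reals or the complex numbers.
  The library class \<open>banach\<close> only knows real scalars, so the scalar multiplication by the field
  is an explicit parameter that extends \<open>scaleR\<close>; for real scalars it is \<open>scaleR\<close> itself.
\<close>

class real_or_complex = real_normed_field +
  assumes isometric_real_or_complex:
    "\<exists>h :: 'a \<Rightarrow> complex.
       (\<forall>x y. h (x + y) = h x + h y) \<and> (\<forall>x y. h (x * y) = h x * h y) \<and>
       (\<forall>x. norm (h x) = norm x) \<and> (range h = \<real> \<or> range h = UNIV)"

instance real :: real_or_complex
  by standard (rule exI[of _ complex_of_real], auto simp: Reals_def)

instance complex :: real_or_complex
  by standard (rule exI[of _ "\<lambda>z. z"], auto)

locale normed_space_over = vector_space scale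
  for scale :: "'k::real_or_complex \<Rightarrow> 'v::real_normed_vector \<Rightarrow> 'v" +
  assumes scale_of_real: "scale (of_real r) x = r *\<^sub>R x"
    and norm_scale: "norm (scale c x) = norm c * norm x"

lemma normed_space_over_real:
  fixes s :: "real \<Rightarrow> 'v::real_normed_vector \<Rightarrow> 'v"
  shows "normed_space_over s \<longleftrightarrow> s = scaleR"
proof
  assume "normed_space_over s"
  then show "s = scaleR"
    using normed_space_over.scale_of_real[of s] by (auto simp: fun_eq_iff)
next
  assume "s = scaleR"
  then show "normed_space_over s"
    by unfold_locales (auto simp: scaleR_right_distrib scaleR_left_distrib)
qed

definition fin_dim :: "('k::field \<Rightarrow> 'v::ab_group_add \<Rightarrow> 'v) \<Rightarrow> 'v set \<Rightarrow> bool" where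
  "fin_dim s V \<longleftrightarrow> (\<exists>B. finite B \<and> V \<subseteq> module.span s B)"

text \<open>
  Elements of the library type of bounded linear maps are only real-linear; the norm of this type
  is the operator norm.
\<close>

definition operators ::
  "('k::real_or_complex \<Rightarrow> 'a::real_normed_vector \<Rightarrow> 'a) \<Rightarrow>
   ('k \<Rightarrow> 'b::real_normed_vector \<Rightarrow> 'b) \<Rightarrow> ('a \<Rightarrow>\<^sub>L 'b) set" where
  "operators sX sY = {T. Vector_Spaces.linear sX sY (blinfun_apply T)}"

text \<open>The first conjunct is needed because \<open>dim\<close> is 0 on infinite-dimensional sets.\<close>

definition rank_less ::
  "('k::real_or_complex \<Rightarrow> 'b::real_normed_vector \<Rightarrow> 'b) \<Rightarrow> nat \<Rightarrow>
   ('a::real_normed_vector \<Rightarrow>\<^sub>L 'b) \<Rightarrow> bool" where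
  "rank_less sY n R \<longleftrightarrow>
     fin_dim sY (range (blinfun_apply R)) \<and>
     vector_space.dim sY (range (blinfun_apply R)) < n"

text \<open>Meaningful for \<open>n \<ge> 1\<close> only.\<close>

definition approx_number ::
  "('k::real_or_complex \<Rightarrow> 'a::real_normed_vector \<Rightarrow> 'a) \<Rightarrow>
   ('k \<Rightarrow> 'b::real_normed_vector \<Rightarrow> 'b) \<Rightarrow> nat \<Rightarrow> ('a \<Rightarrow>\<^sub>L 'b) \<Rightarrow> real" where
  "approx_number sX sY n T = Inf {norm (T - R) | R. R \<in> operators sX sY \<and> rank_less sY n R}"

text \<open>
  The terms are nonnegative, so finiteness of the quasi-norm is convergence of the series of
  \<open>q\<close>-th powers. The series over \<open>n \<ge> 1\<close> is indexed by \<open>Suc n\<close>.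
\<close>

definition approx_space ::
  "('k::real_or_complex \<Rightarrow> 'a::real_normed_vector \<Rightarrow> 'a) \<Rightarrow>
   ('k \<Rightarrow> 'b::real_normed_vector \<Rightarrow> 'b) \<Rightarrow> real \<Rightarrow> real \<Rightarrow> ('a \<Rightarrow>\<^sub>L 'b) set" where
  "approx_space sX sY p q =
     {T \<in> operators sX sY.
        summable (\<lambda>n. (real (Suc n) powr (1/p - 1/q) * approx_number sX sY (Suc n) T) powr q)}"

end

theory Submission
  imports Defs "Jordan_Normal_Form.Determinant"
begin

text \<open>
  Both claims follow once, for all p > 0 and r < s, some operator lies in the space with parameters
  p, s but not in the one with parameters p, r; in particular the spaces never collapse. Hahn-Banach
  and a determinant maximization give biorthogonal systems of any length N in X and Y with constants
  at most 2, and hence operators of rank N and norm at most 2 N whose N-th approximation number is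
  at least 1 / (2 N). Since approximation errors can be approximated again, this polynomial lower
  bound excludes every uniform estimate of the form C n powr -\<gamma> for the approximation numbers of
  normalized finite rank operators. Maximizing n powr \<gamma> * a n over n and truncating the rank
  then produces bumps, that is, operators whose contribution to the quasi-norm is concentrated near
  a single index, which can be chosen arbitrarily large. A lacunary sum of bumps with coefficients
  in \<open>\<ell>\<^sub>s\<close> but not in \<open>\<ell>\<^sub>r\<close> is the required operator. Different p are separated by
  squeezing all spaces of an intermediate parameter between the two given ones.
\<close>

section \<open>Bounded linear functionals\<close>

definition sublinear :: "('v::real_vector \<Rightarrow> real) \<Rightarrow> bool" where
  "sublinear p \<longleftrightarrow> (\<forall>x y. p (x + y) \<le> p x + p y) \<and> (\<forall>x. \<forall>t\<ge>0. p (t *\<^sub>R x) = t * p x)"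

text \<open>The inequality at the factor \<open>1 / t\<close> is the converse of the inequality at
  \<open>t\<close>, so one direction of homogeneity suffices.\<close>

lemma sublinearI:
  assumes add: "\<And>x y. p (x + y) \<le> p x + p y"
    and zero: "p 0 = 0"
    and hom: "\<And>t x. t > 0 \<Longrightarrow> p (t *\<^sub>R x) \<le> t * p x"
  shows "sublinear p"
  unfolding sublinear_def
proof (intro conjI allI impI)
  fix x and t :: real
  assume "t \<ge> 0"
  show "p (t *\<^sub>R x) = t * p x"
  proof (cases "t = 0")
    case False
    with \<open>t \<ge> 0\<close> have t: "t > 0" by simp
    have "p x = p ((1 / t) *\<^sub>R (t *\<^sub>R x))" using t by simp
    also have "\<dots> \<le> (1 / t) * p (t *\<^sub>R x)" using t by (intro hom) simp
    finally have "t * p x \<le> p (t *\<^sub>R x)" using t by (simp add: field_simps)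
    with hom[OF t, of x] show ?thesis by simp
  qed (simp add: zero)
qed (fact add)

lemma sublinear_add: "sublinear p \<Longrightarrow> p (x + y) \<le> p x + p y"
  and sublinear_scaleR: "sublinear p \<Longrightarrow> t \<ge> 0 \<Longrightarrow> p (t *\<^sub>R x) = t * p x"
  by (auto simp: sublinear_def)

lemma sublinear_zero: "sublinear p \<Longrightarrow> p 0 = 0"
  using sublinear_scaleR[of p 0 0] by simp

lemma sublinear_ge_neg: "sublinear p \<Longrightarrow> - p (- x) \<le> p x"
  using sublinear_add[of p x "- x"] by (simp add: sublinear_zero)

lemma sublinear_norm: "sublinear (norm :: 'v::real_normed_vector \<Rightarrow> real)"
  by (simp add: sublinear_def norm_triangle_ineq)

text \<open>The auxiliary functional of the Hahn-Banach argument. For sublinear \<open>p\<close>,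
  the choice \<open>t = 0\<close> places it below \<open>p\<close>, and \<open>t = 1\<close> yields
  additivity as soon as it coincides with \<open>p\<close>.\<close>

definition sublinear_shift :: "('v::real_vector \<Rightarrow> real) \<Rightarrow> 'v \<Rightarrow> 'v \<Rightarrow> real" where
  "sublinear_shift p y x = (INF t\<in>{0..}. p (x + t *\<^sub>R y) - t * p y)"

lemma sublinear_shift_le:
  assumes p: "sublinear p" and t: "t \<ge> 0"
  shows "sublinear_shift p y x \<le> p (x + t *\<^sub>R y) - t * p y"
  unfolding sublinear_shift_def
proof (rule cINF_lower)
  have "- p (- x) \<le> p (x + t *\<^sub>R y) - t * p y" if "t \<ge> 0" for t
    using sublinear_add[OF p, of "x + t *\<^sub>R y" "- x"] that by (simp add: sublinear_scaleR[OF p])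
  then show "bdd_below ((\<lambda>t. p (x + t *\<^sub>R y) - t * p y) ` {0..})"
    by (intro bdd_belowI2) auto
qed (use t in auto)

lemma sublinear_shift_greatest:
  assumes "\<And>t. t \<ge> 0 \<Longrightarrow> c \<le> p (x + t *\<^sub>R y) - t * p y"
  shows "c \<le> sublinear_shift p y x"
  unfolding sublinear_shift_def using assms by (intro cINF_greatest) auto

text \<open>Subadditivity: parameters \<open>t\<close> for \<open>x\<close> and \<open>u\<close> for
  \<open>z\<close> combine to \<open>t + u\<close> for \<open>x + z\<close>, and the two infima are
  then taken one after the other. Homogeneity: the parameter is rescaled along with the
  vector.\<close>

lemma sublinear_sublinear_shift:
  assumes p: "sublinear p"
  shows "sublinear (sublinear_shift p y)"
proof (rule sublinearI)
  fix x z
  have "sublinear_shift p y (x + z) \<le> (p (x + t *\<^sub>R y) - t * p y) + (p (z + u *\<^sub>R y) - u * p y)"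
    if "t \<ge> 0" "u \<ge> 0" for t u
    using sublinear_shift_le[OF p, of "t + u" y "x + z"] that
      sublinear_add[OF p, of "x + t *\<^sub>R y" "z + u *\<^sub>R y"]
    by (simp add: algebra_simps)
  then have "sublinear_shift p y (x + z) - (p (z + u *\<^sub>R y) - u * p y) \<le> sublinear_shift p y x"
    if "u \<ge> 0" for u
    using that by (intro sublinear_shift_greatest) (simp add: algebra_simps)
  then have "sublinear_shift p y (x + z) - sublinear_shift p y x \<le> sublinear_shift p y z"
    by (intro sublinear_shift_greatest) (simp add: algebra_simps)
  then show "sublinear_shift p y (x + z) \<le> sublinear_shift p y x + sublinear_shift p y z"
    by simp
next
  show "sublinear_shift p y 0 = 0"
  proof (rule antisym)
    show "sublinear_shift p y 0 \<le> 0"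
      using sublinear_shift_le[OF p, of 0 y 0] by (simp add: sublinear_zero[OF p])
    show "0 \<le> sublinear_shift p y 0"
      by (rule sublinear_shift_greatest) (simp add: sublinear_scaleR[OF p])
  qed
next
  fix t :: real and x
  assume t: "t > 0"
  have "sublinear_shift p y (t *\<^sub>R x) / t \<le> p (x + s *\<^sub>R y) - s * p y" if "s \<ge> 0" for s
    using sublinear_shift_le[OF p, of "t * s" y "t *\<^sub>R x"] t that
      sublinear_scaleR[OF p, of t "x + s *\<^sub>R y"]
    by (simp add: field_simps scaleR_right_distrib)
  then have "sublinear_shift p y (t *\<^sub>R x) / t \<le> sublinear_shift p y x"
    by (rule sublinear_shift_greatest)
  then show "sublinear_shift p y (t *\<^sub>R x) \<le> t * sublinear_shift p y x"
    using t by (simp add: field_simps)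
qed

text \<open>Zorn's lemma for the reversed pointwise order. The pointwise infimum bounds a chain from
  below; it is finite because every member \<open>q\<close> satisfies
  \<open>- p (- x) \<le> q x\<close>.\<close>

lemma ex_minimal_sublinear:
  assumes p: "sublinear p"
  obtains m where "sublinear m" "m \<le> p" "\<And>q. sublinear q \<Longrightarrow> q \<le> m \<Longrightarrow> q = m"
proof -
  define A where "A = {q. sublinear q \<and> q \<le> p}"
  have "\<exists>m\<in>A. \<forall>a\<in>A. a \<le> m \<longrightarrow> a = m"
  proof (rule predicate_Zorn[where P = "\<lambda>a b. b \<le> a"])
    show "partial_order_on A (relation_of (\<lambda>a b. b \<le> a) A)"
      by (rule partial_order_on_relation_ofI) auto
  next
    fix C assume "C \<in> Chains (relation_of (\<lambda>a b. b \<le> a) A)"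
    then have chain: "\<And>q q'. q \<in> C \<Longrightarrow> q' \<in> C \<Longrightarrow> q \<le> q' \<or> q' \<le> q" and CA: "C \<subseteq> A"
      by (auto simp: Chains_def relation_of_def)
    show "\<exists>u\<in>A. \<forall>a\<in>C. u \<le> a"
    proof (cases "C = {}")
      case True
      then show ?thesis using p by (auto simp: A_def)
    next
      case False
      then obtain q0 where q0: "q0 \<in> C" by auto
      define u where "u x = (INF q\<in>C. q x)" for x
      have sub: "sublinear q" if "q \<in> C" for q
        using CA that by (auto simp: A_def)
      have below: "q \<le> p" if "q \<in> C" for q
        using CA that by (auto simp: A_def)
      have "- p (- x) \<le> q x" if "q \<in> C" for q x
        using sublinear_ge_neg[OF sub[OF that], of x] below[OF that]
        by (auto simp: le_fun_def dest: spec[of _ "- x"])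
      then have u_le: "u x \<le> q x" if "q \<in> C" for q x
        unfolding u_def using that by (intro cINF_lower bdd_belowI2) auto
      have u_ge: "c \<le> u x" if "\<And>q. q \<in> C \<Longrightarrow> c \<le> q x" for c x
        unfolding u_def using that False by (intro cINF_greatest) auto
      have "sublinear u"
      proof (rule sublinearI)
        fix x y
        \<comment> \<open>The two infima may be approached by different members of the chain; the
          smaller of the two serves for both summands.\<close>
        have "u (x + y) \<le> q x + q' y" if q: "q \<in> C" "q' \<in> C" for q q'
        proof -
          obtain m where m: "m \<in> C" "m \<le> q" "m \<le> q'"
            using chain[OF q] q by auto
          have "u (x + y) \<le> m x + m y"
            using u_le[OF m(1), of "x + y"] sublinear_add[OF sub[OF m(1)], of x y] by simp
          then show ?thesis using le_funD[OF m(2), of x] le_funD[OF m(3), of y] by simp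
        qed
        then have "u (x + y) - q' y \<le> u x" if "q' \<in> C" for q'
          using that by (intro u_ge) (simp add: algebra_simps)
        then have "u (x + y) - u x \<le> u y"
          by (intro u_ge) (simp add: algebra_simps)
        then show "u (x + y) \<le> u x + u y" by simp
      next
        have "q 0 = 0" if "q \<in> C" for q
          using sublinear_zero[OF sub[OF that]] .
        then show "u 0 = 0" using u_le[OF q0, of 0] u_ge[of 0 0] q0 by force
      next
        fix t :: real and x
        assume t: "t > 0"
        have "u (t *\<^sub>R x) / t \<le> q x" if "q \<in> C" for q
          using u_le[OF that, of "t *\<^sub>R x"] sublinear_scaleR[OF sub[OF that], of t x] t
          by (simp add: field_simps)
        then have "u (t *\<^sub>R x) / t \<le> u x" by (rule u_ge)
        then show "u (t *\<^sub>R x) \<le> t * u x" using t by (simp add: field_simps)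
      qed
      moreover have "u \<le> p"
        using u_le[OF q0] below[OF q0] by (auto simp: le_fun_def intro: order_trans)
      ultimately show ?thesis
        using u_le by (auto simp: A_def le_fun_def)
    qed
  qed
  then obtain m where m: "m \<in> A" "\<And>a. a \<in> A \<Longrightarrow> a \<le> m \<Longrightarrow> a = m" by blast
  show thesis
    using m by (intro that[of m]) (auto simp: A_def intro: order_trans)
qed

text \<open>A minimal sublinear functional equals all its shifts. The shift estimate with parameter
  1 then reads as superadditivity.\<close>

lemma ex_linear_below_sublinear:
  assumes p: "sublinear p"
  obtains f where "linear f" "f \<le> p"
proof -
  obtain f where f: "sublinear f" "f \<le> p" and min: "\<And>q. sublinear q \<Longrightarrow> q \<le> f \<Longrightarrow> q = f"
    using ex_minimal_sublinear[OF p] by blast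
  have "sublinear_shift f y \<le> f" for y
    using sublinear_shift_le[OF f(1), of 0 y] by (auto simp: le_fun_def)
  then have shift: "sublinear_shift f y = f" for y
    using min[OF sublinear_sublinear_shift[OF f(1)]] by blast
  have add: "f (x + y) = f x + f y" for x y
    using sublinear_shift_le[OF f(1), of 1 y x] sublinear_add[OF f(1), of x y]
    by (simp add: shift)
  have neg: "f (- x) = - f x" for x
    using add[of x "- x"] sublinear_zero[OF f(1)] by simp
  have "f (t *\<^sub>R x) = t * f x" for t x
    using sublinear_scaleR[OF f(1), of t x] sublinear_scaleR[OF f(1), of "- t" x] neg[of "t *\<^sub>R x"]
    by (cases "t \<ge> 0") auto
  with add have "linear f" by (intro linearI) auto
  with f(2) show thesis by (rule that[rotated])
qed

text \<open>
  A linear functional below the norm shifted along x is dominated by the norm and takes at - x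
  a value of at most - norm x.
\<close>

lemma ex_bounded_linear_nonzero:
  fixes x :: "'v::real_normed_vector"
  assumes "x \<noteq> 0"
  obtains f :: "'v \<Rightarrow> real" where "linear f" "\<And>y. \<bar>f y\<bar> \<le> norm y" "f x \<noteq> 0"
proof -
  obtain f where f: "linear f" "f \<le> sublinear_shift norm x"
    using ex_linear_below_sublinear[OF sublinear_sublinear_shift[OF sublinear_norm]] by blast
  interpret linear f by fact
  have le: "f y \<le> norm (y + t *\<^sub>R x) - t * norm x" if "t \<ge> 0" for t y
    using f(2) sublinear_shift_le[OF sublinear_norm that, of x y]
    by (auto simp: le_fun_def intro: order_trans)
  have "\<bar>f y\<bar> \<le> norm y" for y
    using le[of 0 y] le[of 0 "- y"] by (simp add: neg)
  moreover have "f x \<noteq> 0"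
    using le[of 1 "- x"] assms by (auto simp: neg)
  ultimately show thesis using f(1) that by blast
qed

text \<open>Replaces the abstract embedding into the complex numbers by real coordinates. The class
  does not state that the embedding fixes the reals; this has to come from the preservation of
  norms.\<close>

lemma real_or_complex_cases:
  obtains (real) "\<And>c :: 'k::real_or_complex. \<exists>a. c = of_real a"
  | (complex) j :: "'k::real_or_complex" where "j * j = - 1" "\<And>c :: 'k::real_or_complex. \<exists>a b. c = of_real a + j * of_real b"
proof -
  obtain h :: "'k \<Rightarrow> complex" where add: "\<And>x y. h (x + y) = h x + h y"
    and mult: "\<And>x y. h (x * y) = h x * h y" and nrm: "\<And>x. norm (h x) = norm x"
    and range: "range h = \<real> \<or> range h = UNIV"
    using isometric_real_or_complex by blast
  have "h x = h (x - y) + h y" for x y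
    using add[of "x - y" y] by simp
  then have inj: "x = y" if "h x = h y" for x y
    using that nrm[of "x - y"] by (metis add_cancel_left_left eq_iff_diff_eq_0 norm_eq_zero)
  have "h 1 = h 1 * h 1" using mult[of 1 1] by simp
  moreover have "h 1 \<noteq> 0" using nrm[of 1] by auto
  ultimately have h1: "h 1 = 1" by simp
  \<comment> \<open>The distances of \<open>z\<close> to 0 and to - 1 agree with those of the real
    number \<open>r\<close>, and these two circles touch only in \<open>r\<close>.\<close>
  have h_of_real: "h (of_real r) = of_real r" for r
  proof -
    define z where "z = h (of_real r)"
    have "norm z = \<bar>r\<bar>" by (simp add: z_def nrm)
    then have 1: "(Re z)\<^sup>2 + (Im z)\<^sup>2 = r\<^sup>2"
      by (metis cmod_power2 power2_abs)
    have "norm (z + 1) = \<bar>r + 1\<bar>"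
      using nrm[of "of_real r + 1"] norm_of_real[of "r + 1", where 'a='k]
      by (simp add: z_def add h1)
    then have 2: "(Re z + 1)\<^sup>2 + (Im z)\<^sup>2 = (r + 1)\<^sup>2"
      by (metis cmod_power2 power2_abs plus_complex.sel one_complex.sel add.right_neutral)
    from 1 2 have "Re z = r" by (simp add: power2_eq_square algebra_simps)
    with 1 have "Im z = 0" by simp
    with \<open>Re z = r\<close> show ?thesis by (simp add: complex_eq_iff flip: z_def)
  qed
  from range show thesis
  proof
    assume R: "range h = \<real>"
    have "\<exists>a. c = of_real a" for c :: 'k
    proof -
      have "h c \<in> \<real>" using R by auto
      then obtain a where "h c = of_real a" by (auto elim: Reals_cases)
      then show ?thesis using inj[of c "of_real a"] h_of_real by auto
    qed
    then show thesis by (rule real)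
  next
    assume C: "range h = UNIV"
    obtain j where j: "h j = \<i>" using C by (metis UNIV_I imageE)
    have "h (- 1) = - 1" using h_of_real[of "- 1"] by simp
    then have "j * j = - 1" by (intro inj) (simp add: mult j)
    moreover have "\<exists>a b. c = of_real a + j * of_real b" for c :: 'k
      by (intro exI[of _ "Re (h c)"] exI[of _ "Im (h c)"] inj)
        (simp add: add mult h_of_real j complex_eq_iff)
    ultimately show thesis by (rule complex)
  qed
qed

section \<open>Bounded functionals that are linear over the scalar field\<close>

definition functional ::
  "('k::real_or_complex \<Rightarrow> 'v::real_normed_vector \<Rightarrow> 'v) \<Rightarrow> ('v \<Rightarrow> 'k) \<Rightarrow> bool" where
  "functional s g \<longleftrightarrow> (\<forall>x y. g (x + y) = g x + g y) \<and> (\<forall>c x. g (s c x) = c * g x) \<and>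
     (\<exists>K. \<forall>x. norm (g x) \<le> K * norm x)"

lemma functional_add: "functional s g \<Longrightarrow> g (x + y) = g x + g y"
  and functional_scale: "functional s g \<Longrightarrow> g (s c x) = c * g x"
  by (auto simp: functional_def)

lemma functional_zero: "functional s g \<Longrightarrow> g 0 = 0"
  using functional_add[of s g 0 0] by simp

lemma functional_diff: "functional s g \<Longrightarrow> g (x - y) = g x - g y"
  using functional_add[of s g "x - y" y] by simp

lemma functional_sum: "functional s g \<Longrightarrow> g (\<Sum>i\<in>A. x i) = (\<Sum>i\<in>A. g (x i))"
  by (induction A rule: infinite_finite_induct) (auto simp: functional_zero functional_add)

lemma functional_bounded:
  assumes "functional s g"
  obtains K where "K \<ge> 0" "\<And>x. norm (g x) \<le> K * norm x"
proof -
  obtain K where K: "\<And>x. norm (g x) \<le> K * norm x"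
    using assms by (auto simp: functional_def)
  have "norm (g x) \<le> max K 0 * norm x" for x
    by (rule order_trans[OF K mult_right_mono]) auto
  then show thesis by (rule that[rotated]) simp
qed

lemma functional_lincomb:
  assumes "finite A" "\<And>i. i \<in> A \<Longrightarrow> functional s (g i)"
  shows "functional s (\<lambda>x. \<Sum>i\<in>A. c i * g i x)"
  unfolding functional_def
proof (intro conjI allI)
  have "\<forall>i\<in>A. \<exists>K. \<forall>x. norm (g i x) \<le> K * norm x"
    using assms(2) by (auto simp: functional_def)
  then obtain K where K: "norm (g i x) \<le> K i * norm x" if "i \<in> A" for i x
    using bchoice by metis
  have "norm (\<Sum>i\<in>A. c i * g i x) \<le> (\<Sum>i\<in>A. norm (c i) * K i) * norm x" for x
    unfolding sum_distrib_right
    by (rule sum_norm_le) (auto simp: norm_mult mult.assoc intro!: mult_left_mono K)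
  then show "\<exists>K. \<forall>x. norm (\<Sum>i\<in>A. c i * g i x) \<le> K * norm x" by blast
next
  fix x y
  have "(\<Sum>i\<in>A. c i * g i (x + y)) = (\<Sum>i\<in>A. c i * g i x + c i * g i y)"
    by (intro sum.cong refl) (simp add: functional_add[OF assms(2)] ring_distribs)
  then show "(\<Sum>i\<in>A. c i * g i (x + y)) = (\<Sum>i\<in>A. c i * g i x) + (\<Sum>i\<in>A. c i * g i y)"
    by (simp add: sum.distrib)
next
  fix a x
  show "(\<Sum>i\<in>A. c i * g i (s a x)) = a * (\<Sum>i\<in>A. c i * g i x)"
    unfolding sum_distrib_left by (intro sum.cong refl) (simp add: functional_scale[OF assms(2)])
qed

text \<open>The shape of the functional that is added in the induction step of
  \<open>ex_biorthogonal\<close>.\<close>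

lemma functional_minus_lincomb:
  assumes "functional s h" "finite A" "\<And>i. i \<in> A \<Longrightarrow> functional s (g i)"
  shows "functional s (\<lambda>x. a * (h x - (\<Sum>i\<in>A. c i * g i x)))"
proof -
  \<comment> \<open>A combination of two functionals, indexed by the booleans.\<close>
  have "functional s (\<lambda>x. \<Sum>i\<in>{False, True}. (if i then a else - a) *
      (if i then h x else (\<Sum>i\<in>A. c i * g i x)))"
  proof (rule functional_lincomb)
    fix i
    show "functional s (\<lambda>x. if i then h x else (\<Sum>i\<in>A. c i * g i x))"
      using assms(1) functional_lincomb[of A s g c] assms(2,3) by (cases i) auto
  qed simp
  then show ?thesis by (simp add: algebra_simps)
qed

section \<open>Separating functionals and biorthogonal systems\<close>

context normed_space_over
begin

lemma ex_functional_nonzero: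
  assumes "x \<noteq> 0"
  obtains g where "functional scale g" "g x \<noteq> 0"
proof -
  obtain f where f: "linear f" "\<And>y. \<bar>f y\<bar> \<le> norm y" "f x \<noteq> 0"
    using ex_bounded_linear_nonzero[OF assms] by blast
  interpret f: linear f by fact
  show thesis
  proof (cases rule: real_or_complex_cases[where 'k = 'k])
    case real
    have "of_real (f (scale c y)) = c * of_real (f y)" for c y
      using real[of c] by (auto simp: scale_of_real f.scale)
    then have "functional scale (\<lambda>y. of_real (f y))"
      using f(2) by (auto simp: functional_def f.add intro!: exI[of _ 1])
    then show thesis using that f(3) by auto
  next
    case (complex j)
    \<comment> \<open>The usual complexification: \<open>g\<close> is the scalar-linear functional
      whose real part is the real-linear \<open>f\<close>.\<close>
    define g where "g y = of_real (f y) - j * of_real (f (scale j y))" for y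
    have g_j: "g (scale j y) = j * g y" for y
    proof -
      have jj: "scale j (scale j y) = - y"
        using complex(1) by (simp add: scale_minus_left)
      show ?thesis
        unfolding g_def jj f.neg using complex(1)
        by (simp add: algebra_simps flip: mult.assoc)
    qed
    have g_real: "g (r *\<^sub>R y) = of_real r * g y" for r y
    proof -
      have "scale j (r *\<^sub>R y) = r *\<^sub>R scale j y"
        by (simp add: mult.commute flip: scale_of_real)
      then show ?thesis by (simp add: g_def f.scale algebra_simps)
    qed
    have g_add: "g (y + z) = g y + g z" for y z
      by (simp add: g_def f.add scale_right_distrib algebra_simps)
    have g_scale: "g (scale c y) = c * g y" for c y
    proof -
      obtain a b where c: "c = of_real a + j * of_real b" using complex(2) by blast
      have "scale c y = a *\<^sub>R y + scale j (b *\<^sub>R y)"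
        by (simp add: c scale_left_distrib scale_of_real flip: scale_scale)
      then show ?thesis by (simp add: c g_add g_j g_real algebra_simps)
    qed
    have "norm j * norm j = 1"
      using complex(1) by (metis norm_minus_cancel norm_mult norm_one)
    then have nj: "norm j = 1"
      by (metis norm_ge_zero power2_eq_1_iff power2_eq_square not_one_le_zero neg_0_le_iff_le)
    have "norm (g y) \<le> 2 * norm y" for y
      using norm_triangle_ineq4[of "of_real (f y)" "j * of_real (f (scale j y))"]
        f(2)[of y] f(2)[of "scale j y"]
      by (simp add: g_def norm_mult nj norm_scale)
    with g_add g_scale have "functional scale g" by (auto simp: functional_def)
    moreover have "g x \<noteq> 0"
    proof
      assume g0: "g x = 0"
      define a b where "a = f x" and "b = f (scale j x)"
      \<comment> \<open>Squaring replaces a comparison of real and imaginary parts: it yields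
        \<open>a * a + b * b = 0\<close>, which forces \<open>f x = 0\<close>.\<close>
      have eq: "of_real a = j * of_real b" using g0 by (simp add: g_def a_def b_def)
      then have "of_real a * of_real a = (j * j) * (of_real b * of_real b :: 'k)"
        by (simp add: algebra_simps)
      then have "(of_real (a * a + b * b) :: 'k) = 0"
        by (simp add: complex(1))
      then have "a * a + b * b = 0" by (simp only: of_real_eq_0_iff)
      then show False using f(3) by (simp add: a_def sum_squares_eq_zero_iff)
    qed
    ultimately show thesis by (rule that)
  qed
qed

text \<open>In the induction step a common zero \<open>z\<close> of the functionals is added to the
  vectors. It exists because otherwise every vector would equal its expansion in the finitely many
  \<open>x k\<close>. A functional that is nonzero at \<open>z\<close> is corrected so as to vanish
  at the earlier vectors.\<close>

lemma ex_biorthogonal: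
  fixes N :: nat
  assumes inf: "\<not> fin_dim scale UNIV"
  shows "\<exists>x g. (\<forall>i<N. functional scale (g i) \<and> norm (x i) = 1) \<and>
    (\<forall>i<N. \<forall>j<N. g i (x j) = of_bool (i = j))"
proof (induction N)
  case (Suc N)
  then obtain x g where g: "\<And>i. i < N \<Longrightarrow> functional scale (g i)"
    and x: "\<And>i. i < N \<Longrightarrow> norm (x i) = 1"
    and gx: "\<And>i j. i < N \<Longrightarrow> j < N \<Longrightarrow> g i (x j) = of_bool (i = j)" by blast
  have "\<exists>z. z \<noteq> 0 \<and> (\<forall>i<N. g i z = 0)"
  proof (rule ccontr)
    assume *: "\<not> ?thesis"
    have "v \<in> span (x ` {..<N})" for v
    proof -
      have "g i (v - (\<Sum>k<N. scale (g k v) (x k))) = 0" if "i < N" for i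
        using g[OF that] that
        by (simp add: functional_diff functional_sum functional_scale gx of_bool_def if_distrib
            sum.delta cong: if_cong)
      then have "v - (\<Sum>k<N. scale (g k v) (x k)) = 0" using * by blast
      then have "v = (\<Sum>k<N. scale (g k v) (x k))" by simp
      also have "\<dots> \<in> span (x ` {..<N})"
        by (intro span_sum span_scale span_base) auto
      finally show ?thesis .
    qed
    then have "fin_dim scale UNIV"
      unfolding fin_dim_def by (intro exI[of _ "x ` {..<N}"]) auto
    with inf show False by simp
  qed
  then obtain z0 where z0: "z0 \<noteq> 0" "\<And>i. i < N \<Longrightarrow> g i z0 = 0" by blast
  define z where "z = scale (of_real (1 / norm z0)) z0"
  have z: "norm z = 1" "\<And>i. i < N \<Longrightarrow> g i z = 0"
    using z0 g by (auto simp: z_def norm_scale functional_scale simp del: of_real_divide)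
  then have "z \<noteq> 0" by auto
  then obtain h where h: "functional scale h" "h z \<noteq> 0" by (rule ex_functional_nonzero)
  define g' where "g' = g(N := \<lambda>v. inverse (h z) * (h v - (\<Sum>i<N. h (x i) * g i v)))"
  define x' where "x' = x(N := z)"
  have "functional scale (g' i)" "norm (x' i) = 1" if "i < Suc N" for i
    using that h g x z functional_minus_lincomb[OF h(1), of "{..<N}" g]
    by (auto simp: g'_def x'_def less_Suc_eq)
  moreover have "(\<Sum>i<N. h (x i) * g i (x j)) = h (x j)" if "j < N" for j
  proof -
    have "(\<Sum>i<N. h (x i) * g i (x j)) = (\<Sum>i<N. if i = j then h (x i) else 0)"
      using that by (intro sum.cong) (auto simp: gx)
    then show ?thesis using that by simp
  qed
  then have "g' i (x' j) = of_bool (i = j)" if "i < Suc N" "j < Suc N" for i j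
    using that gx z(2) h(2) by (auto simp: g'_def x'_def less_Suc_eq)
  ultimately show ?case by blast
qed auto

text \<open>
  Auerbach systems up to a factor 2: the determinant of a biorthogonal family of functionals is
  almost maximal at x among tuples in the unit ball, and f i is the quotient of determinants from
  Cramer's rule. The global domain of the functionals makes compactness unnecessary.
\<close>

lemma ex_almost_auerbach:
  fixes N :: nat
  assumes inf: "\<not> fin_dim scale UNIV"
  shows "\<exists>x f. \<forall>i<N. functional scale (f i) \<and> norm (x i) \<le> 1 \<and>
    (\<forall>j<N. f i (x j) = of_bool (i = j)) \<and> (\<forall>v. norm (f i v) \<le> 2 * norm v)"
proof -
  obtain x0 g where g: "\<And>i. i < N \<Longrightarrow> functional scale (g i)"
    and x0: "\<And>i. i < N \<Longrightarrow> norm (x0 i) = 1"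
    and gx: "\<And>i j. i < N \<Longrightarrow> j < N \<Longrightarrow> g i (x0 j) = of_bool (i = j)"
    using ex_biorthogonal[OF inf, of N] by blast
  have "\<forall>i\<in>{..<N}. \<exists>K\<ge>0. \<forall>v. norm (g i v) \<le> K * norm v"
    using functional_bounded[OF g] by (metis lessThan_iff)
  then obtain K where K0: "\<And>i. i < N \<Longrightarrow> K i \<ge> 0"
    and K: "\<And>i v. i < N \<Longrightarrow> norm (g i v) \<le> K i * norm v"
    by (metis lessThan_iff)
  define M where "M x = mat N N (\<lambda>(l, k). g k (x l))" for x
  define D where "D x = Determinant.det (M x)" for x
  have M: "M x \<in> carrier_mat N N" for x by (simp add: M_def)
  define P where "P = {p. p permutes {0..<N}}"
  have P: "finite P" "\<And>p l. p \<in> P \<Longrightarrow> l < N \<Longrightarrow> p l < N"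
    by (auto simp: P_def finite_permutations dest: permutes_in_image[of _ _ "_::nat"])
  \<comment> \<open>The Leibniz formula serves twice: it bounds the determinant on \<open>U\<close>,
    and it exhibits the determinant as a combination of functionals in each row.\<close>
  have D_eq: "D x = (\<Sum>p\<in>P. signof p * (\<Prod>l = 0..<N. g (p l) (x l)))" for x
    unfolding D_def P_def det_def'[OF M]
    by (intro sum.cong refl arg_cong2[where f = "(*)"] prod.cong) (auto simp: M_def P_def dest: P(2)[unfolded P_def, simplified])
  define U where "U = {x :: nat \<Rightarrow> 'v. \<forall>i<N. norm (x i) \<le> 1}"
  have bdd: "bdd_above ((\<lambda>x. norm (D x)) ` U)"
  proof (rule bdd_aboveI2)
    fix x assume x: "x \<in> U"
    show "norm (D x) \<le> (\<Sum>p\<in>P. (\<Prod>l = 0..<N. K (p l)))"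
      unfolding D_eq
    proof (rule sum_norm_le)
      fix p assume p: "p \<in> P"
      have "norm (signof p :: 'k) = 1" by (auto simp: sign_def)
      moreover have "norm (\<Prod>l = 0..<N. g (p l) (x l)) \<le> (\<Prod>l = 0..<N. K (p l))"
        unfolding prod_norm[symmetric]
      proof (intro prod_mono conjI norm_ge_zero)
        fix l assume "l \<in> {0..<N}"
        then have l: "l < N" "p l < N" using P(2)[OF p] by auto
        have "norm (g (p l) (x l)) \<le> K (p l) * norm (x l)" by (rule K[OF l(2)])
        also have "\<dots> \<le> K (p l) * 1" using x l K0 by (intro mult_left_mono) (auto simp: U_def)
        finally show "norm (g (p l) (x l)) \<le> K (p l)" by simp
      qed
      ultimately show "norm (signof p * (\<Prod>l = 0..<N. g (p l) (x l))) \<le> (\<Prod>l = 0..<N. K (p l))"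
        by (simp add: norm_mult)
    qed
  qed
  define \<sigma> where "\<sigma> = (SUP x\<in>U. norm (D x))"
  \<comment> \<open>Biorthogonality gives a tuple in \<open>U\<close> with determinant 1, so the
    supremum is at least 1 and an almost maximal determinant is nonzero.\<close>
  have "M x0 = 1\<^sub>m N" by (rule eq_matI) (auto simp: M_def gx)
  then have "D x0 = 1" by (simp add: D_def)
  moreover have x0U: "x0 \<in> U" using x0 by (auto simp: U_def)
  ultimately have \<sigma>1: "\<sigma> \<ge> 1" using cSUP_upper[OF x0U bdd] by (simp add: \<sigma>_def)
  \<comment> \<open>Exceeding half of the supremum is what produces the constant 2 in the bound of
    the functionals.\<close>
  have "\<sigma> / 2 < (SUP x\<in>U. norm (D x))" using \<sigma>1 by (simp flip: \<sigma>_def)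
  then obtain x where x: "x \<in> U" "\<sigma> / 2 < norm (D x)"
    using less_cSUP_iff[of U "\<lambda>x. norm (D x)"] bdd x0U by blast
  then have Dx: "D x \<noteq> 0" using \<sigma>1 by auto
  define f where "f i v = inverse (D x) * D (x(i := v))" for i v
  have D_upd: "D (x(i := v)) = (\<Sum>p\<in>P. (signof p * (\<Prod>l\<in>{0..<N} - {i}. g (p l) (x l))) * g (p i) v)"
    if "i < N" for i v
    unfolding D_eq using that
    by (intro sum.cong refl) (simp add: prod.remove[of "{0..<N}" i] algebra_simps)
  have func: "functional scale (f i)" if i: "i < N" for i
  proof -
    have "f i = (\<lambda>v. \<Sum>p\<in>P. (inverse (D x) * (signof p * (\<Prod>l\<in>{0..<N} - {i}. g (p l) (x l)))) * g (p i) v)"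
      by (intro ext) (simp add: f_def D_upd[OF i] sum_distrib_left mult.assoc)
    then show ?thesis
      using P i by (simp only:) (intro functional_lincomb g, auto)
  qed
  show ?thesis
  proof (intro exI[of _ x] exI[of _ f] allI impI conjI)
    fix i assume i: "i < N"
    show "functional scale (f i)" by (rule func[OF i])
    show "norm (x i) \<le> 1" using x i by (simp add: U_def)
    show "f i (x j) = of_bool (i = j)" if j: "j < N" for j
    proof (cases "i = j")
      case False
      have "D (x(i := x j)) = 0"
        unfolding D_def
      proof (rule det_identical_rows[OF M False i j])
        show "row (M (x(i := x j))) i = row (M (x(i := x j))) j"
          using i j by (intro eq_vecI) (auto simp: M_def)
      qed
      with False show ?thesis by (simp add: f_def)
    qed (use Dx in \<open>simp add: f_def\<close>)
    have unit: "norm (f i u) \<le> 2" if "norm u \<le> 1" for u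
    proof -
      have "x(i := u) \<in> U" using x(1) that by (auto simp: U_def)
      then have "norm (D (x(i := u))) \<le> 2 * norm (D x)"
        using cSUP_upper[OF _ bdd, of "x(i := u)"] x(2) by (simp add: \<sigma>_def)
      then show ?thesis using Dx by (simp add: f_def norm_mult norm_divide norm_inverse field_simps)
    qed
    fix v
    show "norm (f i v) \<le> 2 * norm v"
    proof (cases "v = 0")
      case False
      define u where "u = scale (of_real (1 / norm v)) v"
      have "norm u \<le> 1" using False by (simp add: u_def norm_scale norm_divide)
      moreover have "f i u = of_real (1 / norm v) * f i v"
        unfolding u_def by (rule functional_scale[OF func[OF i]])
      then have "norm (f i u) = norm (f i v) / norm v"
        using False by (simp add: norm_mult norm_divide)
      ultimately show ?thesis
        using unit[of u] False by (simp add: pos_divide_le_eq)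
    qed (simp add: functional_zero[OF func[OF i]])
  qed
qed

end

section \<open>Sums of powers\<close>

text \<open>For \<open>e \<ge> 1\<close> the last term dominates all others. For
  \<open>e < 1\<close> the mean value theorem compares each term with an increment of
  \<open>real M powr e / e\<close>, and the increments telescope.\<close>

lemma sum_powr_le:
  fixes e :: real
  assumes e: "e > 0"
  obtains C where "C > 0" "\<And>M. (\<Sum>m<M. real (Suc m) powr (e - 1)) \<le> C * real M powr e"
proof (cases "e \<ge> 1")
  case True
  have "(\<Sum>m<M. real (Suc m) powr (e - 1)) \<le> 1 * real M powr e" for M
  proof (cases "M = 0")
    case False
    have "(\<Sum>m<M. real (Suc m) powr (e - 1)) \<le> (\<Sum>m<M. real M powr (e - 1))"
      using True by (intro sum_mono powr_mono2) auto
    also have "\<dots> = real M powr e" using False powr_add[of "real M" 1 "e - 1"] by simp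
    finally show ?thesis by simp
  qed simp
  then show thesis by (rule that[rotated]) simp
next
  case False
  have "(\<Sum>m<M. real (Suc m) powr (e - 1)) \<le> (1 / e) * real M powr e" for M
  proof (induction M)
    case (Suc M)
    have "e * real (Suc M) powr (e - 1) \<le> real (Suc M) powr e - real M powr e"
    proof (cases "M = 0")
      case True
      with \<open>\<not> e \<ge> 1\<close> show ?thesis by simp
    next
      case M: False
      have "\<exists>z. real M < z \<and> z < real (Suc M) \<and>
          real (Suc M) powr e - real M powr e = (real (Suc M) - real M) * (e * z powr (e - 1))"
        using M by (intro MVT2) (auto intro!: derivative_eq_intros simp: powr_diff)
      then obtain z where z: "real M < z" "z < real (Suc M)"
        "real (Suc M) powr e - real M powr e = e * z powr (e - 1)" by auto
      have "real (Suc M) powr (e - 1) \<le> z powr (e - 1)"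
        using z False by (intro powr_mono2') auto
      then show ?thesis using z(3) e by simp
    qed
    then have "real (Suc M) powr (e - 1) \<le> (1 / e) * real (Suc M) powr e - (1 / e) * real M powr e"
      using e by (simp add: field_simps del: of_nat_Suc)
    with Suc.IH show ?case by (simp del: of_nat_Suc)
  qed simp
  then show thesis using e by (intro that[of "1 / e"]) auto
qed

text \<open>The block has \<open>h\<close> terms, each comparable to
  \<open>real h powr (e - 1)\<close>. The minimum in \<open>c\<close> covers both increasing and
  decreasing terms.\<close>

lemma sum_powr_ge:
  fixes e :: real
  obtains c where "c > 0" "\<And>h. c * real h powr e \<le> (\<Sum>m = h..<2 * h. real (Suc m) powr (e - 1))"
proof -
  define c :: real where "c = min 1 (2 powr (e - 1))"
  have "c * real h powr e \<le> (\<Sum>m = h..<2 * h. real (Suc m) powr (e - 1))" for h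
  proof (cases "h = 0")
    case False
    have "c * real h powr (e - 1) \<le> real (Suc m) powr (e - 1)" if m: "m \<in> {h..<2 * h}" for m
    proof (cases "e \<ge> 1")
      case True
      have "c * real h powr (e - 1) \<le> 1 * real h powr (e - 1)"
        by (intro mult_right_mono) (auto simp: c_def)
      also have "\<dots> \<le> real (Suc m) powr (e - 1)"
        using True m by (simp add: powr_mono2)
      finally show ?thesis .
    next
      case e: False
      have "c * real h powr (e - 1) \<le> 2 powr (e - 1) * real h powr (e - 1)"
        by (intro mult_right_mono) (auto simp: c_def)
      also have "\<dots> = (2 * real h) powr (e - 1)" by (simp add: powr_mult)
      also have "\<dots> \<le> real (Suc m) powr (e - 1)"
        using e m by (intro powr_mono2') auto
      finally show ?thesis .
    qed
    then have "(\<Sum>m = h..<2 * h. c * real h powr (e - 1)) \<le> (\<Sum>m = h..<2 * h. real (Suc m) powr (e - 1))"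
      by (rule sum_mono)
    moreover have "real h powr e = real h * real h powr (e - 1)"
      using False powr_add[of "real h" 1 "e - 1"] by simp
    ultimately show ?thesis by (simp add: algebra_simps)
  qed simp
  moreover have "c > 0" by (simp add: c_def)
  ultimately show thesis by (rule that[rotated])
qed

section \<open>Approximation numbers\<close>

locale operator_pair =
  X: normed_space_over sX + Y: normed_space_over sY
  for sX :: "'k::real_or_complex \<Rightarrow> 'a::banach \<Rightarrow> 'a"
    and sY :: "'k \<Rightarrow> 'b::banach \<Rightarrow> 'b" +
  assumes inf_dim_X: "\<not> fin_dim sX UNIV" and inf_dim_Y: "\<not> fin_dim sY UNIV"
begin

section \<open>Scalar-linear operators and bounds on their rank\<close>

abbreviation ops :: "('a \<Rightarrow>\<^sub>L 'b) set" where
  "ops \<equiv> operators sX sY"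

lemma ops_iff: "T \<in> ops \<longleftrightarrow> (\<forall>c x. blinfun_apply T (sX c x) = sY c (blinfun_apply T x))"
  unfolding operators_def Vector_Spaces.linear_iff
  using X.vector_space_axioms Y.vector_space_axioms by (auto simp: blinfun.add_right)

lemma sY_scaleR: "sY c (r *\<^sub>R y) = r *\<^sub>R sY c y"
  by (simp add: mult.commute flip: Y.scale_of_real)

lemma ops_zero: "0 \<in> ops"
  and ops_add: "S \<in> ops \<Longrightarrow> T \<in> ops \<Longrightarrow> S + T \<in> ops"
  and ops_scaleR: "T \<in> ops \<Longrightarrow> r *\<^sub>R T \<in> ops"
  by (auto simp: ops_iff blinfun.bilinear_simps Y.scale_right_distrib sY_scaleR)

text \<open>Ensures that the sum of a convergent series of scalar-linear operators is again
  scalar-linear.\<close>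

lemma closed_ops: "closed ops"
proof -
  have "continuous_on UNIV (sY c)" for c
  proof -
    have "norm (sY c x - sY c y) \<le> norm c * norm (x - y)" for x y
      by (simp add: Y.norm_scale flip: Y.scale_right_diff_distrib)
    then have "(norm c)-lipschitz_on UNIV (sY c)"
      by (intro lipschitz_onI) (auto simp: dist_norm)
    then show ?thesis by (rule lipschitz_on_continuous_on)
  qed
  then have "closed {T. blinfun_apply T (sX c x) = sY c (blinfun_apply T x)}" for c x
    by (intro closed_Collect_eq continuous_intros continuous_on_compose2[where f = "\<lambda>T. blinfun_apply T x" and g = "sY c"]) auto
  moreover have "ops = (\<Inter>c. \<Inter>x. {T. blinfun_apply T (sX c x) = sY c (blinfun_apply T x)})"
    by (auto simp: ops_iff)
  ultimately show ?thesis by auto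
qed

text \<open>A spanning set of bounded size instead of a dimension makes subadditivity of the rank a
  union of spanning sets. The bound \<open>m\<close> is inclusive, in contrast to
  \<open>rank_less\<close>.\<close>

definition rk :: "nat \<Rightarrow> ('a \<Rightarrow>\<^sub>L 'b) \<Rightarrow> bool" where
  "rk m R \<longleftrightarrow> R \<in> ops \<and> (\<exists>B. finite B \<and> card B \<le> m \<and> range (blinfun_apply R) \<subseteq> Y.span B)"

lemma rk_iff: "rk m R \<longleftrightarrow> R \<in> ops \<and> rank_less sY (Suc m) R"
proof -
  define V where "V = range (blinfun_apply R)"
  have "fin_dim sY V \<and> Y.dim V \<le> m \<longleftrightarrow> (\<exists>B. finite B \<and> card B \<le> m \<and> V \<subseteq> Y.span B)"
  proof
    assume *: "fin_dim sY V \<and> Y.dim V \<le> m"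
    then obtain C where C: "finite C" "V \<subseteq> Y.span C" by (auto simp: fin_dim_def)
    obtain B where B: "B \<subseteq> V" "Y.independent B" "V \<subseteq> Y.span B" "card B = Y.dim V"
      using Y.basis_exists by blast
    have "finite B"
      using Y.independent_span_bound[OF C(1) B(2)] B(1) C(2) by auto
    with B * show "\<exists>B. finite B \<and> card B \<le> m \<and> V \<subseteq> Y.span B" by metis
  next
    assume "\<exists>B. finite B \<and> card B \<le> m \<and> V \<subseteq> Y.span B"
    then show "fin_dim sY V \<and> Y.dim V \<le> m"
      unfolding fin_dim_def using Y.dim_le_card by (meson le_trans)
  qed
  then show ?thesis by (auto simp: rk_def rank_less_def V_def less_Suc_eq_le)
qed

lemma rk_ops: "rk m R \<Longrightarrow> R \<in> ops"
  by (simp add: rk_def)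

lemma rk_mono: "rk m R \<Longrightarrow> m \<le> n \<Longrightarrow> rk n R"
  unfolding rk_def by (meson le_trans)

lemma rk_0_iff: "rk 0 R \<longleftrightarrow> R = 0"
proof
  assume "rk 0 R"
  then have "range (blinfun_apply R) \<subseteq> {0}" by (auto simp: rk_def)
  then show "R = 0" by (intro blinfun_eqI) (auto simp: image_subset_iff)
next
  assume "R = 0"
  then show "rk 0 R" by (auto simp: rk_def ops_zero intro!: exI[of _ "{}"])
qed

lemma rk_add:
  assumes "rk m R" "rk n S"
  shows "rk (m + n) (R + S)"
proof -
  obtain B C where B: "finite B" "card B \<le> m" "range (blinfun_apply R) \<subseteq> Y.span B"
    and C: "finite C" "card C \<le> n" "range (blinfun_apply S) \<subseteq> Y.span C"
    using assms by (auto simp: rk_def)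
  have "Y.span B \<subseteq> Y.span (B \<union> C)" "Y.span C \<subseteq> Y.span (B \<union> C)"
    by (auto intro!: Y.span_mono)
  then have "range (blinfun_apply (R + S)) \<subseteq> Y.span (B \<union> C)"
    using B(3) C(3) by (auto simp: blinfun.add_left intro!: Y.span_add)
  moreover have "card (B \<union> C) \<le> m + n"
    using card_Un_le[of B C] B(2) C(2) by linarith
  ultimately show ?thesis
    using assms B(1) C(1) by (auto simp: rk_def ops_add intro!: exI[of _ "B \<union> C"])
qed

lemma rk_scaleR:
  assumes "rk m R"
  shows "rk m (r *\<^sub>R R)"
proof -
  obtain B where B: "finite B" "card B \<le> m" "range (blinfun_apply R) \<subseteq> Y.span B"
    using assms by (auto simp: rk_def)
  then have "range (blinfun_apply (r *\<^sub>R R)) \<subseteq> Y.span B"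
    by (auto simp: blinfun.scaleR_left simp flip: Y.scale_of_real intro!: Y.span_scale)
  then show ?thesis using assms B by (auto simp: rk_def ops_scaleR)
qed

lemma rk_diff: "rk m R \<Longrightarrow> rk n S \<Longrightarrow> rk (m + n) (R - S)"
  using rk_add[of m R n "(- 1) *\<^sub>R S"] rk_scaleR[of n S "- 1"] by simp

lemma rk_sum:
  "finite A \<Longrightarrow> (\<And>i. i \<in> A \<Longrightarrow> rk (m i) (R i)) \<Longrightarrow> rk (\<Sum>i\<in>A. m i) (\<Sum>i\<in>A. R i)"
  by (induction A rule: finite_induct) (simp_all add: rk_0_iff rk_add)

text \<open>The shift by one turns the subadditivity of the approximation numbers into \<open>E_add\<close>.\<close>

definition E :: "nat \<Rightarrow> ('a \<Rightarrow>\<^sub>L 'b) \<Rightarrow> real" where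
  "E m T = approx_number sX sY (Suc m) T"

lemma E_eq: "E m T = (INF R\<in>Collect (rk m). norm (T - R))"
proof -
  have "{norm (T - R) |R. R \<in> ops \<and> rank_less sY (Suc m) R} = (\<lambda>R. norm (T - R)) ` Collect (rk m)"
    by (auto simp: rk_iff)
  then show ?thesis by (simp add: E_def approx_number_def)
qed

lemma E_le: "rk m R \<Longrightarrow> E m T \<le> norm (T - R)"
  unfolding E_eq by (rule cINF_lower) (auto intro: bdd_belowI2[of _ 0])

lemma rk_zero: "rk m 0"
  using rk_mono[of 0 0 m] by (simp add: rk_0_iff)

lemma E_greatest: "(\<And>R. rk m R \<Longrightarrow> c \<le> norm (T - R)) \<Longrightarrow> c \<le> E m T"
  unfolding E_eq using rk_zero[of m] by (intro cINF_greatest) auto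

lemma E_less: "E m T < c \<Longrightarrow> \<exists>R. rk m R \<and> norm (T - R) < c"
  using E_greatest[of m c T] by (meson not_le)

lemma E_nonneg: "0 \<le> E m T"
  by (rule E_greatest) simp

lemma E_le_norm: "E m T \<le> norm T"
  using E_le[OF rk_zero, of m T] by simp

lemma E_0: "E 0 T = norm T"
  using E_greatest[of 0 "norm T" T] E_le_norm[of 0 T] by (simp add: rk_0_iff)

lemma E_antimono: "m \<le> n \<Longrightarrow> E n T \<le> E m T"
  by (intro E_greatest E_le) (rule rk_mono)

lemma E_eq_0: "rk m T \<Longrightarrow> E m T = 0"
  using E_le[of m T T] E_nonneg[of m T] by simp

text \<open>The sum of approximants of ranks at most \<open>m\<close> and \<open>n\<close> is an
  approximant of rank at most \<open>m + n\<close>; the infima are taken one at a time.\<close>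

lemma E_add: "E (m + n) (S + T) \<le> E m S + E n T"
proof -
  have "E (m + n) (S + T) \<le> norm (S - R) + norm (T - R')" if "rk m R" "rk n R'" for R R'
    using E_le[OF rk_add[OF that], of "S + T"] norm_triangle_ineq[of "S - R" "T - R'"]
    by (simp add: algebra_simps)
  then have "E (m + n) (S + T) - norm (S - R) \<le> E n T" if "rk m R" for R
    using that by (intro E_greatest) (simp add: algebra_simps)
  then have "E (m + n) (S + T) - E n T \<le> E m S"
    by (intro E_greatest) (simp add: algebra_simps)
  then show ?thesis by simp
qed

lemma E_perturb: "E m T \<le> E m S + norm (T - S)"
  using E_add[of m 0 S "T - S"] by (simp add: E_0)

text \<open>Scaling an approximant gives one inequality; the same inequality for the factor
  \<open>1 / c\<close> gives the other.\<close>

lemma E_scaleR: "E m (c *\<^sub>R T) = \<bar>c\<bar> * E m T"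
proof -
  have le: "E m (c *\<^sub>R T) \<le> \<bar>c\<bar> * E m T" if "c \<noteq> 0" for c T
  proof -
    have "E m (c *\<^sub>R T) / \<bar>c\<bar> \<le> E m T"
    proof (rule E_greatest)
      fix R assume "rk m R"
      then have "E m (c *\<^sub>R T) \<le> norm (c *\<^sub>R T - c *\<^sub>R R)" by (intro E_le rk_scaleR)
      also have "\<dots> = \<bar>c\<bar> * norm (T - R)" by (simp flip: scaleR_right_diff_distrib)
      finally show "E m (c *\<^sub>R T) / \<bar>c\<bar> \<le> norm (T - R)"
        using that by (simp add: pos_divide_le_eq mult.commute)
    qed
    then show ?thesis using that by (simp add: field_simps)
  qed
  show ?thesis
  proof (cases "c = 0")
    case True
    then show ?thesis by (simp add: E_eq_0 rk_zero)
  next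
    case False
    then have "E m T \<le> \<bar>1 / c\<bar> * E m (c *\<^sub>R T)"
      using le[of "1 / c" "c *\<^sub>R T"] by simp
    then have "\<bar>c\<bar> * E m T \<le> E m (c *\<^sub>R T)"
      using False by (simp add: field_simps)
    with le[OF False, of T] show ?thesis by simp
  qed
qed

section \<open>Operators with slowly decaying approximation numbers, and bumps\<close>

lemma ex_kernel_combination:
  assumes R: "rk m R"
  obtains \<alpha> where "\<exists>i\<le>m. \<alpha> i \<noteq> 0" "blinfun_apply R (\<Sum>i\<le>m. sX (\<alpha> i) (x i)) = 0"
proof -
  have eq: "blinfun_apply R (\<Sum>i\<le>m. sX (\<alpha> i) (x i)) = (\<Sum>i\<le>m. sY (\<alpha> i) (blinfun_apply R (x i)))" for \<alpha>
    using rk_ops[OF R] by (simp add: blinfun.sum_right ops_iff)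
  define z where "z i = blinfun_apply R (x i)" for i
  obtain B where B: "finite B" "card B \<le> m" "range (blinfun_apply R) \<subseteq> Y.span B"
    using R by (auto simp: rk_def)
  have "\<exists>\<alpha>. (\<exists>i\<le>m. \<alpha> i \<noteq> 0) \<and> (\<Sum>i\<le>m. sY (\<alpha> i) (z i)) = 0"
  \<comment> \<open>The \<open>m + 1\<close> images lie in the span of at most \<open>m\<close>
    vectors, hence are dependent. Coinciding images are treated apart because dependence of the set
    of images does not see repetitions.\<close>
  proof (cases "inj_on z {..m}")
    case False
    then obtain i j where ij: "i \<le> m" "j \<le> m" "i \<noteq> j" "z i = z j" by (auto simp: inj_on_def)
    define \<alpha> :: "nat \<Rightarrow> 'k" where "\<alpha> k = (if k = i then 1 else if k = j then - 1 else 0)" for k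
    have "(\<Sum>k\<le>m. sY (\<alpha> k) (z k)) = (\<Sum>k\<in>{i, j}. sY (\<alpha> k) (z k))"
      using ij by (intro sum.mono_neutral_right) (auto simp: \<alpha>_def)
    also have "\<dots> = 0" using ij by (simp add: \<alpha>_def)
    finally show ?thesis using ij(1) by (intro exI[of _ \<alpha>]) (auto simp: \<alpha>_def)
  next
    case True
    have "Y.dependent (z ` {..m})"
    proof (rule ccontr)
      assume "Y.independent (z ` {..m})"
      then have "card (z ` {..m}) \<le> card B"
        using Y.independent_span_bound[OF B(1)] B(3) by (auto simp: z_def image_subset_iff)
      then show False using B(2) card_image[OF True] by simp
    qed
    then obtain u where u: "\<exists>v\<in>z ` {..m}. u v \<noteq> 0" "(\<Sum>v\<in>z ` {..m}. sY (u v) v) = 0"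
      by (auto simp: Y.dependent_finite)
    then show ?thesis
      by (intro exI[of _ "u \<circ> z"]) (auto simp: sum.reindex[OF True])
  qed
  then show thesis using that eq by (auto simp: z_def)
qed

text \<open>The operator maps \<open>x i\<close> to \<open>y i\<close> for two almost Auerbach
  systems. An \<open>R\<close> of rank at most \<open>m\<close> kills some combination
  \<open>v\<close> of the \<open>x i\<close>. If \<open>a\<close> is its largest coefficient in
  norm, then \<open>norm v\<close> is at most \<open>Suc m\<close> times \<open>a\<close>, while the
  functional \<open>e k\<close> recovers that coefficient from \<open>t v\<close> and so
  \<open>a \<le> 2 * norm (t v)\<close>.\<close>

lemma ex_operator_slow_decay:
  "\<exists>T. rk (Suc m) T \<and> norm T \<le> 2 * real (Suc m) \<and> 1 / (2 * real (Suc m)) \<le> E m T"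
proof -
  let ?N = "Suc m"
  obtain f x where f: "\<And>i. i < ?N \<Longrightarrow> functional sX (f i)" and x: "\<And>i. i < ?N \<Longrightarrow> norm (x i) \<le> 1"
    and fx: "\<And>i j. i < ?N \<Longrightarrow> j < ?N \<Longrightarrow> f i (x j) = of_bool (i = j)"
    and f_le: "\<And>i v. i < ?N \<Longrightarrow> norm (f i v) \<le> 2 * norm v"
    using X.ex_almost_auerbach[OF inf_dim_X, of ?N] by blast
  obtain e y where e: "\<And>i. i < ?N \<Longrightarrow> functional sY (e i)" and y: "\<And>i. i < ?N \<Longrightarrow> norm (y i) \<le> 1"
    and ey: "\<And>i j. i < ?N \<Longrightarrow> j < ?N \<Longrightarrow> e i (y j) = of_bool (i = j)"
    and e_le: "\<And>i v. i < ?N \<Longrightarrow> norm (e i v) \<le> 2 * norm v"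
    using Y.ex_almost_auerbach[OF inf_dim_Y, of ?N] by blast
  define t where "t v = (\<Sum>i\<le>m. sY (f i v) (y i))" for v
  have t_bound: "norm (t v) \<le> norm v * (2 * real ?N)" for v
  proof -
    have "norm (t v) \<le> (\<Sum>i\<le>m. 2 * norm v)"
      unfolding t_def
    proof (rule sum_norm_le)
      fix i assume "i \<in> {..m}"
      then have "norm (f i v) * norm (y i) \<le> (2 * norm v) * 1"
        by (intro mult_mono f_le y) auto
      then show "norm (sY (f i v) (y i)) \<le> 2 * norm v" by (simp add: Y.norm_scale)
    qed
    then show ?thesis by (simp add: algebra_simps)
  qed
  have t_scale: "t (sX c v) = sY c (t v)" for c v
    unfolding t_def Y.scale_sum_right by (intro sum.cong refl) (simp add: functional_scale[OF f])
  have "bounded_linear t"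
  proof (rule bounded_linear_intro)
    show "t (v + w) = t v + t w" for v w
      unfolding t_def sum.distrib[symmetric]
      by (intro sum.cong refl) (simp add: functional_add[OF f] Y.scale_left_distrib)
    show "t (r *\<^sub>R v) = r *\<^sub>R t v" for r v
      using t_scale[of "of_real r" v] by (simp add: X.scale_of_real Y.scale_of_real)
  qed (fact t_bound)
  then have T: "blinfun_apply (Blinfun t) = t" by (rule bounded_linear_Blinfun_apply)
  have "rk ?N (Blinfun t)"
  proof -
    have "card (y ` {..m}) \<le> ?N" using card_image_le[of "{..m}" y] by simp
    moreover have "t v \<in> Y.span (y ` {..m})" for v
      unfolding t_def by (intro Y.span_sum Y.span_scale Y.span_base) auto
    ultimately show ?thesis
      by (auto simp: rk_def ops_iff T t_scale intro!: exI[of _ "y ` {..m}"])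
  qed
  moreover have "norm (Blinfun t) \<le> 2 * real ?N"
    by (rule norm_blinfun_bound) (use t_bound in \<open>auto simp: T mult.commute\<close>)
  moreover have "1 / (2 * real ?N) \<le> E m (Blinfun t)"
  proof (rule E_greatest)
    fix R assume R: "rk m R"
    obtain \<alpha> where \<alpha>: "\<exists>i\<le>m. \<alpha> i \<noteq> 0" "blinfun_apply R (\<Sum>i\<le>m. sX (\<alpha> i) (x i)) = 0"
      using ex_kernel_combination[OF R] by blast
    define v where "v = (\<Sum>i\<le>m. sX (\<alpha> i) (x i))"
    define a where "a = Max ((\<lambda>i. norm (\<alpha> i)) ` {..m})"
    have "a \<in> (\<lambda>i. norm (\<alpha> i)) ` {..m}" unfolding a_def by (intro Max_in) auto
    then obtain k where k: "k \<le> m" "a = norm (\<alpha> k)" by auto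
    have a: "norm (\<alpha> i) \<le> a" if "i \<le> m" for i
      unfolding a_def using that by (intro Max_ge) auto
    have "a > 0" using \<alpha>(1) a by (metis less_le_trans zero_less_norm_iff)
    have "norm v \<le> (\<Sum>i\<le>m. a)"
      unfolding v_def
    proof (rule sum_norm_le)
      fix i assume "i \<in> {..m}"
      then have "norm (\<alpha> i) * norm (x i) \<le> a * 1"
        using \<open>a > 0\<close> by (intro mult_mono a x) auto
      then show "norm (sX (\<alpha> i) (x i)) \<le> a" by (simp add: X.norm_scale)
    qed
    then have v: "norm v \<le> real ?N * a" by simp
    have fv: "f i v = \<alpha> i" if "i \<le> m" for i
    proof -
      have "f i v = (\<Sum>j\<le>m. if j = i then \<alpha> j else 0)"
        unfolding v_def using that
        by (subst functional_sum[OF f]) (auto simp: functional_scale[OF f] fx intro!: sum.cong)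
      then show ?thesis using that by simp
    qed
    have "e k (t v) = (\<Sum>j\<le>m. if j = k then \<alpha> j else 0)"
      unfolding t_def using k
      by (subst functional_sum[OF e]) (auto simp: functional_scale[OF e] ey fv intro!: sum.cong)
    then have "e k (t v) = \<alpha> k" using k by simp
    then have "a \<le> 2 * norm (t v)" using e_le[of k "t v"] k by simp
    also have "t v = blinfun_apply (Blinfun t - R) v"
      using \<alpha>(2) by (simp add: T blinfun.diff_left flip: v_def)
    also have "norm \<dots> \<le> norm (Blinfun t - R) * norm v" by (rule norm_blinfun)
    also have "\<dots> \<le> norm (Blinfun t - R) * (real ?N * a)" by (intro mult_left_mono v) simp
    finally have "a * 1 \<le> a * (2 * real ?N * norm (Blinfun t - R))" by (simp add: algebra_simps)
    then have "1 \<le> 2 * real ?N * norm (Blinfun t - R)" using \<open>a > 0\<close> by simp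
    then show "1 / (2 * real ?N) \<le> norm (Blinfun t - R)"
      by (simp add: divide_le_eq mult.commute del: of_nat_Suc)
  qed
  ultimately show ?thesis by blast
qed

text \<open>
  A uniform bound E m S \<le> K (m + 1) powr -\<gamma> norm S could be iterated, by approximating S, then
  the error, then the error of that, to decay of arbitrary polynomial order, which the operators
  built from Auerbach systems exclude.
\<close>

lemma E_unbounded:
  assumes \<gamma>: "\<gamma> > 0"
  shows "\<exists>n S m. rk n S \<and> K * norm S < real (Suc m) powr \<gamma> * E m S"
proof (rule ccontr)
  assume neg: "\<not> ?thesis"
  define L where "L = max K 1"
  have L: "L > 0" by (simp add: L_def)
  have bound: "E m S \<le> L * real (Suc m) powr - \<gamma> * norm S" if "rk n S" for n S m
  proof -
    have "real (Suc m) powr \<gamma> * E m S \<le> K * norm S" using neg that by (auto simp: not_less)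
    also have "\<dots> \<le> L * norm S" by (intro mult_right_mono) (auto simp: L_def)
    finally show ?thesis by (simp add: powr_minus field_simps del: of_nat_Suc)
  qed
  \<comment> \<open>Twice the assumed bound, so that it strictly exceeds \<open>E m S\<close> for
    nonzero \<open>S\<close> and an approximant within it exists.\<close>
  define \<theta> where "\<theta> m = 2 * L * real (Suc m) powr - \<gamma>" for m
  have \<theta>: "\<theta> m > 0" for m using L by (simp add: \<theta>_def)
  \<comment> \<open>The rank \<open>n\<close> stays arbitrary because the residual
    \<open>S - R\<close> has larger rank than \<open>S\<close>.\<close>
  have iter: "E (k * m) S \<le> \<theta> m ^ k * norm S" if "rk n S" for k m n S
    using that
  proof (induction k arbitrary: n S)
    case (Suc k)
    show ?case
    proof (cases "S = 0")
      case True
      then show ?thesis by (simp add: E_eq_0 rk_zero)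
    next
      case False
      then have "L * real (Suc m) powr - \<gamma> * norm S < \<theta> m * norm S"
        using L by (simp add: \<theta>_def del: of_nat_Suc)
      then have "E m S < \<theta> m * norm S" using bound[OF Suc.prems, of m] by linarith
      then obtain R where R: "rk m R" "norm (S - R) < \<theta> m * norm S" using E_less by blast
      have "E (m + k * m) (R + (S - R)) \<le> E m R + E (k * m) (S - R)" by (rule E_add)
      also have "\<dots> = E (k * m) (S - R)" by (simp add: E_eq_0[OF R(1)])
      also have "\<dots> \<le> \<theta> m ^ k * norm (S - R)"
        by (rule Suc.IH[OF rk_diff[OF Suc.prems R(1)]])
      also have "\<dots> \<le> \<theta> m ^ k * (\<theta> m * norm S)"
        using R(2) \<theta>[of m] by (intro mult_left_mono) auto
      finally show ?thesis by (simp add: algebra_simps)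
    qed
  qed (simp add: E_0)
  \<comment> \<open>With this \<open>k\<close> the iterated factor decays at least like the power -
    3 of \<open>Suc m\<close>. The operators of slow decay allow only the power - 2, since
    \<open>k * m + 1\<close> grows linearly in \<open>m\<close>; hence \<open>Suc m\<close> would be
    bounded.\<close>
  obtain k :: nat where k: "3 / \<gamma> \<le> real k" using real_arch_simple by blast
  define C where "C = 4 * (real k + 1)\<^sup>2 * (2 * L) ^ k"
  have "real (Suc m) \<le> C" for m
  proof -
    let ?M = "real (Suc m)" and ?N = "real (Suc (k * m))"
    obtain T where T: "rk (Suc (k * m)) T" "norm T \<le> 2 * ?N" "1 / (2 * ?N) \<le> E (k * m) T"
      using ex_operator_slow_decay by blast
    have "1 / (2 * ?N) \<le> \<theta> m ^ k * norm T" using T(3) iter[OF T(1)] by (rule order_trans)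
    also have "\<dots> \<le> \<theta> m ^ k * (2 * ?N)" using T(2) \<theta>[of m] by (intro mult_left_mono) auto
    finally have 1: "1 \<le> \<theta> m ^ k * (4 * ?N\<^sup>2)"
      by (simp add: field_simps power2_eq_square del: of_nat_Suc)
    have "\<theta> m ^ k = (2 * L) ^ k * ?M powr (- \<gamma> * real k)"
      by (simp add: \<theta>_def power_mult_distrib powr_powr flip: powr_realpow)
    also have "?M powr (- \<gamma> * real k) \<le> ?M powr - 3"
      using k \<gamma> by (intro powr_mono) (auto simp: field_simps)
    finally have 2: "\<theta> m ^ k \<le> (2 * L) ^ k * ?M powr - 3" using L by simp
    have "?N \<le> (real k + 1) * ?M" by (simp add: algebra_simps)
    then have 3: "?N\<^sup>2 \<le> ((real k + 1) * ?M)\<^sup>2" by (intro power_mono) auto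
    have "1 \<le> ((2 * L) ^ k * ?M powr - 3) * (4 * ((real k + 1) * ?M)\<^sup>2)"
      using L by (intro order_trans[OF 1] mult_mono 2 mult_left_mono 3) auto
    also have "\<dots> = C * ?M ^ 2 / ?M ^ 3"
      by (simp add: C_def powr_minus power_mult_distrib divide_inverse mult_ac del: of_nat_Suc)
    finally show ?thesis
      by (simp add: power2_eq_square power3_eq_cube field_simps del: of_nat_Suc)
  qed
  moreover obtain m :: nat where m: "C < real m" using reals_Archimedean2 by blast
  ultimately have "real (Suc m) < real m" by (rule le_less_trans)
  then show False by simp
qed

text \<open>\<open>S\<close> violates the bound with constant \<open>real L powr \<gamma>\<close>,
  and \<open>n - 1\<close> is an index where the weighted numbers \<open>w\<close> are maximal; the
  violation forces \<open>L \<le> n\<close>. Maximality bounds all \<open>E m S\<close> by a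
  multiple of \<open>real (Suc m) powr - \<gamma>\<close> with equality at \<open>n - 1\<close>.
  Truncating to rank \<open>A * n\<close> and rescaling keeps this profile, with \<open>A\<close>
  independent of \<open>L\<close>.\<close>

lemma ex_bump:
  assumes \<gamma>: "\<gamma> > 0"
  obtains A :: nat where "A \<ge> 1"
    "\<And>L. \<exists>n\<ge>L. \<exists>B. n \<ge> 1 \<and> rk (A * n) B \<and> 1 \<le> E (n - 1) B \<and>
       (\<forall>m. E m B \<le> 6 * (real n / real (Suc m)) powr \<gamma>)"
proof -
  \<comment> \<open>The 4 is a factor 2 for the strict inequality in the choice of \<open>R\<close>
    and a factor 2 for losing at most half of \<open>E m0 S\<close>.\<close>
  obtain A :: nat where A0: "4 powr (1 / \<gamma>) \<le> real A" using real_arch_simple by blast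
  have "4 powr (1 / \<gamma>) > (0::real)" by simp
  then have A1: "A \<ge> 1" using A0 by linarith
  have "4 = (4 powr (1 / \<gamma>)) powr \<gamma>" using \<gamma> by (simp add: powr_powr)
  also have "\<dots> \<le> real A powr \<gamma>" using A0 \<gamma> by (intro powr_mono2) auto
  finally have A4: "4 \<le> real A powr \<gamma>" .
  have "\<exists>n\<ge>L. \<exists>B. n \<ge> 1 \<and> rk (A * n) B \<and> 1 \<le> E (n - 1) B \<and>
       (\<forall>m. E m B \<le> 6 * (real n / real (Suc m)) powr \<gamma>)" for L
  proof -
    obtain n0 S m1 where S: "rk n0 S" and m1: "real L powr \<gamma> * norm S < real (Suc m1) powr \<gamma> * E m1 S"
      using E_unbounded[OF \<gamma>] by blast
    define w where "w m = real (Suc m) powr \<gamma> * E m S" for m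
    \<comment> \<open>\<open>E m S\<close> vanishes from \<open>n0\<close> on, so this finite
      maximum is the maximum over all indices.\<close>
    define \<mu> where "\<mu> = Max (w ` {..n0})"
    have "\<mu> \<in> w ` {..n0}" unfolding \<mu>_def by (intro Max_in) auto
    then obtain m0 where m0: "\<mu> = w m0" by auto
    have w_le: "w m \<le> \<mu>" for m
    proof (cases "m \<le> n0")
      case True
      then show ?thesis unfolding \<mu>_def by (intro Max_ge) auto
    next
      case False
      then have "w m = 0" using E_eq_0[OF rk_mono[OF S]] by (simp add: w_def)
      moreover have "0 \<le> w m0" by (simp add: w_def E_nonneg)
      ultimately show ?thesis by (simp add: m0)
    qed
    have "0 \<le> real L powr \<gamma> * norm S" by simp
    also have gt: "\<dots> < \<mu>" using m1 w_le[of m1] by (simp add: w_def)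
    finally have \<mu>: "\<mu> > 0" .
    define n where "n = Suc m0"
    have n: "n \<ge> 1" "n - 1 = m0" by (auto simp: n_def)
    have "\<mu> \<le> real n powr \<gamma> * norm S"
      unfolding m0 w_def n_def by (intro mult_left_mono E_le_norm) simp
    with gt have "real L powr \<gamma> * norm S < real n powr \<gamma> * norm S" by simp
    then have "real L powr \<gamma> < real n powr \<gamma>" by (rule mult_right_less_imp_less) simp
    then have "L \<le> n" using \<gamma> powr_mono2[of \<gamma> "real n" "real L"] by (cases "L \<le> n") auto
    have ES: "E m S \<le> \<mu> * real (Suc m) powr - \<gamma>" for m
      using w_le[of m] by (simp add: w_def powr_minus field_simps del: of_nat_Suc)
    define l where "l = A * n"
    define \<eta> where "\<eta> = 2 * \<mu> * real (Suc l) powr - \<gamma>"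
    have "\<mu> * real (Suc l) powr - \<gamma> < \<eta>" using \<mu> by (simp add: \<eta>_def del: of_nat_Suc)
    then have "E l S < \<eta>" using ES[of l] by linarith
    then obtain R where R: "rk l R" "norm (S - R) < \<eta>" using E_less by blast
    have "real (Suc l) powr - \<gamma> \<le> (real A * real n) powr - \<gamma>"
      using \<gamma> A1 n by (intro powr_mono2') (auto simp: l_def)
    also have "\<dots> = real A powr - \<gamma> * real n powr - \<gamma>" by (simp add: powr_mult)
    also have "\<dots> \<le> (1 / 4) * real n powr - \<gamma>"
      using le_imp_inverse_le[OF A4] by (intro mult_right_mono) (auto simp: powr_minus)
    finally have \<eta>_le: "\<eta> \<le> \<mu> * real n powr - \<gamma> / 2"
      using \<mu> by (simp add: \<eta>_def field_simps del: of_nat_Suc)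
    \<comment> \<open>The factor normalizes the lower bound
      \<open>\<mu> * real n powr - \<gamma> / 2\<close> for \<open>E m0 R\<close> to 1.\<close>
    define B where "B = (2 * real n powr \<gamma> / \<mu>) *\<^sub>R R"
    have c: "2 * real n powr \<gamma> / \<mu> > 0" using \<mu> n by simp
    have EB: "E m B = 2 * real n powr \<gamma> / \<mu> * E m R" for m
      using \<mu> by (simp add: B_def E_scaleR)
    have "rk (A * n) B" using rk_scaleR[OF R(1)] by (simp add: B_def l_def)
    moreover have "1 \<le> E (n - 1) B"
    proof -
      have "\<mu> * real n powr - \<gamma> = E m0 S"
        by (simp add: m0 w_def n_def powr_minus field_simps del: of_nat_Suc)
      also have "\<dots> \<le> E m0 R + \<eta>" using E_perturb[of m0 S R] R(2) by simp
      finally have "\<mu> * real n powr - \<gamma> / 2 \<le> E m0 R" using \<eta>_le by simp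
      then show ?thesis unfolding EB n(2)
        using \<mu> n by (simp add: powr_minus field_simps)
    qed
    moreover have "E m B \<le> 6 * (real n / real (Suc m)) powr \<gamma>" for m
    proof (cases "m \<le> l")
      case True
      \<comment> \<open>Up to the rank \<open>l\<close> the truncation error is at most twice the
        bound for \<open>E m S\<close>; together they give 3, and 6 after rescaling.\<close>
      have "\<eta> \<le> 2 * \<mu> * real (Suc m) powr - \<gamma>"
        unfolding \<eta>_def using True \<gamma> \<mu> by (intro mult_left_mono powr_mono2') auto
      then have "E m R \<le> 3 * \<mu> * real (Suc m) powr - \<gamma>"
        using E_perturb[of m R S] R(2) ES[of m] by (simp add: norm_minus_commute)
      then have "E m B \<le> 2 * real n powr \<gamma> / \<mu> * (3 * \<mu> * real (Suc m) powr - \<gamma>)"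
        unfolding EB using c by (intro mult_left_mono) auto
      also have "\<dots> = 6 * (real n / real (Suc m)) powr \<gamma>"
        using \<mu> by (simp add: powr_divide powr_minus field_simps del: of_nat_Suc)
      finally show ?thesis .
    next
      case False
      then have "E m B = 0" using E_eq_0[OF rk_mono[OF R(1)]] by (simp add: EB)
      then show ?thesis by simp
    qed
    ultimately show ?thesis using \<open>L \<le> n\<close> n(1) by blast
  qed
  with A1 show thesis by (rule that)
qed

section \<open>Approximation spaces\<close>

lemma approx_space_iff:
  assumes "q > 0"
  shows "T \<in> approx_space sX sY p q \<longleftrightarrow>
    T \<in> ops \<and> summable (\<lambda>m. real (Suc m) powr (q / p - 1) * E m T powr q)"
proof -
  have "(1 / p - 1 / q) * q = q / p - 1" using assms by (simp add: field_simps)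
  then have "(real (Suc m) powr (1 / p - 1 / q) * E m T) powr q =
      real (Suc m) powr (q / p - 1) * E m T powr q" for m
    by (simp add: powr_mult powr_powr E_nonneg)
  then show ?thesis by (simp add: approx_space_def E_def)
qed

text \<open>The embedding into the weak space. The numbers decrease, so each of the \<open>h\<close>
  terms with index in \<open>{h..<2 * h}\<close>, where \<open>h = m div 2\<close>, contains at
  least \<open>E m T powr q\<close>; their sum is at most the whole series.\<close>

lemma approx_space_bound:
  assumes p: "p > 0" and q: "q > 0" and T: "T \<in> approx_space sX sY p q"
  obtains W where "\<And>m. E m T \<le> W * real (Suc m) powr (- 1 / p)"
proof -
  define e where "e = q / p"
  define f where "f m = real (Suc m) powr (e - 1) * E m T powr q" for m
  have f: "summable f" using T q by (simp add: approx_space_iff f_def[abs_def] e_def)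
  have f0: "f m \<ge> 0" for m by (simp add: f_def)
  obtain c where c: "c > 0" "\<And>h. c * real h powr e \<le> (\<Sum>m = h..<2 * h. real (Suc m) powr (e - 1))"
    using sum_powr_ge by blast
  define S where "S = 4 powr e * suminf f / c"
  have e: "e > 0" using p q by (simp add: e_def)
  have large: "E m T powr q * real (Suc m) powr e \<le> S" if "m \<ge> 2" for m
  proof -
    define h where "h = m div 2"
    have "Suc m \<le> 4 * h" using that unfolding h_def by presburger
    then have "real (Suc m) \<le> real (4 * h)" by (simp only: of_nat_le_iff)
    then have h: "2 * h \<le> m" "real (Suc m) \<le> 4 * real h" by (auto simp: h_def)
    have "c * real h powr e * E m T powr q \<le>
        (\<Sum>k = h..<2 * h. real (Suc k) powr (e - 1)) * E m T powr q"
      by (intro mult_right_mono c) simp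
    also have "\<dots> \<le> (\<Sum>k = h..<2 * h. f k)"
      unfolding sum_distrib_right f_def using h(1) q
      by (intro sum_mono mult_left_mono powr_mono2 E_antimono) (auto simp: E_nonneg)
    also have "\<dots> \<le> suminf f" by (intro sum_le_suminf f f0) auto
    finally have 1: "real h powr e * E m T powr q \<le> suminf f / c"
      using c(1) by (simp add: field_simps)
    have "real (Suc m) powr e \<le> (4 * real h) powr e" using h e by (intro powr_mono2) auto
    also have "\<dots> = 4 powr e * real h powr e" by (simp add: powr_mult)
    finally have "E m T powr q * real (Suc m) powr e \<le> E m T powr q * (4 powr e * real h powr e)"
      by (intro mult_left_mono) auto
    also have "\<dots> = 4 powr e * (real h powr e * E m T powr q)" by simp
    also have "\<dots> \<le> 4 powr e * (suminf f / c)" by (intro mult_left_mono 1) simp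
    finally show ?thesis by (simp add: S_def)
  qed
  \<comment> \<open>The indices 0 and 1, for which the block is too short, are covered by the
    norm.\<close>
  define S' where "S' = max S (norm T powr q * 2 powr e)"
  have "E m T powr q * real (Suc m) powr e \<le> S'" for m
  proof (cases "m \<ge> 2")
    case True
    with large[OF True] show ?thesis by (simp add: S'_def)
  next
    case False
    have "E m T powr q * real (Suc m) powr e \<le> norm T powr q * 2 powr e"
      using False q e by (intro mult_mono powr_mono2 E_le_norm) (auto simp: E_nonneg)
    then show ?thesis by (simp add: S'_def)
  qed
  then have Eq: "E m T powr q \<le> S' * real (Suc m) powr - e" for m
    by (simp add: powr_minus field_simps del: of_nat_Suc)
  have "E m T \<le> S' powr (1 / q) * real (Suc m) powr (- 1 / p)" for m
  proof -
    have "E m T = (E m T powr q) powr (1 / q)" using q by (simp add: powr_powr E_nonneg)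
    also have "\<dots> \<le> (S' * real (Suc m) powr - e) powr (1 / q)"
      using q by (intro powr_mono2 Eq) auto
    also have "\<dots> = S' powr (1 / q) * real (Suc m) powr (- 1 / p)"
      using q p by (simp add: powr_mult powr_powr e_def S'_def)
    finally show ?thesis .
  qed
  then show thesis by (rule that)
qed

text \<open>The weak bound of order - 1 / p leaves terms of exponent
  \<open>q' / p' - 1 - q' / p\<close>, which is below - 1 whatever the second parameters
  are.\<close>

lemma approx_space_mono:
  assumes "0 < p" "p < p'" "0 < q" "0 < q'"
  shows "approx_space sX sY p q \<subseteq> approx_space sX sY p' q'"
proof
  fix T assume T: "T \<in> approx_space sX sY p q"
  obtain W where W: "\<And>m. E m T \<le> W * real (Suc m) powr (- 1 / p)"
    using approx_space_bound[OF assms(1,3) T] by blast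
  have "0 \<le> W" using W[of 0] E_nonneg[of 0 T] by simp
  define e where "e = q' / p' - 1 - q' / p"
  have "e < - 1" using assms by (simp add: e_def divide_strict_left_mono)
  then have "summable (\<lambda>m. real m powr e)" by (simp add: summable_real_powr_iff)
  then have "summable (\<lambda>m. real (Suc m) powr e)" by (simp only: summable_Suc_iff[of "\<lambda>m. real m powr e"])
  then have "summable (\<lambda>m. W powr q' * real (Suc m) powr e)" by (rule summable_mult)
  then have "summable (\<lambda>m. real (Suc m) powr (q' / p' - 1) * E m T powr q')"
  proof (rule summable_comparison_test')
    fix m
    have "real (Suc m) powr (q' / p' - 1) * E m T powr q' \<le>
        real (Suc m) powr (q' / p' - 1) * (W * real (Suc m) powr (- 1 / p)) powr q'"
      using assms by (intro mult_left_mono powr_mono2 W) (auto simp: E_nonneg)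
    also have "\<dots> = W powr q' * (real (Suc m) powr (q' / p' - 1) * real (Suc m) powr (- q' / p))"
      using \<open>0 \<le> W\<close> by (simp add: powr_mult powr_powr)
    also have "real (Suc m) powr (q' / p' - 1) * real (Suc m) powr (- q' / p) = real (Suc m) powr e"
      by (simp add: e_def flip: powr_add)
    finally show "norm (real (Suc m) powr (q' / p' - 1) * E m T powr q') \<le> W powr q' * real (Suc m) powr e"
      by simp
  qed
  then show "T \<in> approx_space sX sY p' q'"
    using T assms by (simp add: approx_space_iff)
qed

text \<open>
  The operator is a lacunary sum of bumps c i * n i powr (- 1 / p) * B i with
  c i = (i + 1) powr (- 1 / r), which lies in \<open>\<ell>\<^sub>s\<close> but not in \<open>\<ell>\<^sub>r\<close>. Near the index n i the
  earlier bumps have small rank and the later ones small norm.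
\<close>

lemma approx_space_not_subset:
  assumes p: "p > 0" and r: "r > 0" and rs: "r < s"
  shows "\<not> approx_space sX sY p s \<subseteq> approx_space sX sY p r"
proof -
  \<comment> \<open>Being smaller than 1 / p, this exponent makes the weighted sum over a bump
    governed by indices of order \<open>n\<close>. It also makes the norm of a scaled bump small, of
    order \<open>n powr - \<gamma>\<close>.\<close>
  define \<gamma> where "\<gamma> = 1 / (2 * p)"
  have \<gamma>: "\<gamma> > 0" using p by (simp add: \<gamma>_def)
  have s: "s > 0" using r rs by simp
  have p_\<gamma>: "t / p = 2 * \<gamma> * t" for t using p by (simp add: \<gamma>_def)
  obtain A :: nat where A: "A \<ge> 1"
    and bump: "\<And>L. \<exists>n\<ge>L. \<exists>B. n \<ge> 1 \<and> rk (A * n) B \<and> 1 \<le> E (n - 1) B \<and>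
       (\<forall>m. E m B \<le> 6 * (real n / real (Suc m)) powr \<gamma>)"
    using ex_bump[OF \<gamma>] by metis
  \<comment> \<open>Growth demanded of the next index: the first entry keeps the total rank of the
    earlier bumps small, the second makes the next scaled bump small in norm compared with the
    present coefficient \<open>d\<close>.\<close>
  define \<Phi> where "\<Phi> n = max (4 * A * n) (nat \<lceil>(24 * real n powr (2 * \<gamma>)) powr (1 / \<gamma>)\<rceil>)" for n
  have "\<exists>nB :: nat \<Rightarrow> nat \<times> ('a \<Rightarrow>\<^sub>L 'b). \<forall>i. (fst (nB i) \<ge> 4 \<and> rk (A * fst (nB i)) (snd (nB i)) \<and>
      1 \<le> E (fst (nB i) - 1) (snd (nB i)) \<and>
      (\<forall>m. E m (snd (nB i)) \<le> 6 * (real (fst (nB i)) / real (Suc m)) powr \<gamma>)) \<and>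
      \<Phi> (fst (nB i)) \<le> fst (nB (Suc i))"
  proof (rule dependent_nat_choice)
    show "\<exists>x :: nat \<times> ('a \<Rightarrow>\<^sub>L 'b). fst x \<ge> 4 \<and> rk (A * fst x) (snd x) \<and> 1 \<le> E (fst x - 1) (snd x) \<and>
      (\<forall>m. E m (snd x) \<le> 6 * (real (fst x) / real (Suc m)) powr \<gamma>)"
      using bump[of 4] by auto
    show "\<exists>y :: nat \<times> ('a \<Rightarrow>\<^sub>L 'b). (fst y \<ge> 4 \<and> rk (A * fst y) (snd y) \<and> 1 \<le> E (fst y - 1) (snd y) \<and>
      (\<forall>m. E m (snd y) \<le> 6 * (real (fst y) / real (Suc m)) powr \<gamma>)) \<and> \<Phi> (fst x) \<le> fst y"
      for x :: "nat \<times> ('a \<Rightarrow>\<^sub>L 'b)"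
      using bump[of "max 4 (\<Phi> (fst x))"] by auto
  qed
  then obtain nB :: "nat \<Rightarrow> nat \<times> ('a \<Rightarrow>\<^sub>L 'b)" where nB: "\<And>i. fst (nB i) \<ge> 4"
    "\<And>i. rk (A * fst (nB i)) (snd (nB i))" "\<And>i. 1 \<le> E (fst (nB i) - 1) (snd (nB i))"
    "\<And>i m. E m (snd (nB i)) \<le> 6 * (real (fst (nB i)) / real (Suc m)) powr \<gamma>"
    "\<And>i. \<Phi> (fst (nB i)) \<le> fst (nB (Suc i))"
    by blast
  define n where "n i = fst (nB i)" for i
  define B where "B i = snd (nB i)" for i
  have n4: "n i \<ge> 4" and rkB: "rk (A * n i) (B i)" and EB_ge: "1 \<le> E (n i - 1) (B i)"
    and EB_le: "E m (B i) \<le> 6 * (real (n i) / real (Suc m)) powr \<gamma>"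
    and n_Suc: "\<Phi> (n i) \<le> n (Suc i)" for i m
    using nB by (auto simp: n_def B_def)
  have npos: "real (n i) > 0" for i using n4[of i] by simp
  have n_Suc1: "4 * (A * n i) \<le> n (Suc i)" for i
    using n_Suc[of i] by (simp add: \<Phi>_def)
  have n_Suc2: "24 * real (n i) powr (2 * \<gamma>) \<le> real (n (Suc i)) powr \<gamma>" for i
  proof -
    have "(24 * real (n i) powr (2 * \<gamma>)) powr (1 / \<gamma>) \<le> real (n (Suc i))"
      using n_Suc[of i] by (simp add: \<Phi>_def)
    then have "((24 * real (n i) powr (2 * \<gamma>)) powr (1 / \<gamma>)) powr \<gamma> \<le> real (n (Suc i)) powr \<gamma>"
      using \<gamma> by (intro powr_mono2) auto
    then show ?thesis using \<gamma> npos[of i] by (simp add: powr_powr)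
  qed
  define c where "c i = real (Suc i) powr (- 1 / r)" for i
  have c: "c i > 0" for i by (simp add: c_def)
  have c_Suc: "c (Suc i) \<le> c i" for i
    unfolding c_def using r by (intro powr_mono2') auto
  define d where "d i = c i * real (n i) powr (- 2 * \<gamma>)" for i
  have d: "d i > 0" for i using c npos[of i] by (simp add: d_def)
  define u where "u i = d i *\<^sub>R B i" for i
  \<comment> \<open>The quarter is the 6 of the bump estimate over the 24 in
    \<open>\<Phi>\<close>.\<close>
  have u_Suc: "norm (u (Suc i)) \<le> d i / 4" for i
  proof -
    let ?n = "real (n (Suc i))"
    have "norm (B (Suc i)) \<le> 6 * ?n powr \<gamma>" using EB_le[of 0 "Suc i"] by (simp add: E_0)
    then have "norm (u (Suc i)) \<le> d (Suc i) * (6 * ?n powr \<gamma>)"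
      using d[of "Suc i"] by (simp add: u_def)
    also have "\<dots> = 6 * c (Suc i) * (?n powr (- 2 * \<gamma>) * ?n powr \<gamma>)" by (simp add: d_def)
    also have "?n powr (- 2 * \<gamma>) * ?n powr \<gamma> = ?n powr - \<gamma>" by (simp flip: powr_add)
    also have "6 * c (Suc i) * ?n powr - \<gamma> \<le> 6 * c i * (real (n i) powr (- 2 * \<gamma>) / 24)"
    proof (rule mult_mono)
      show "?n powr - \<gamma> \<le> real (n i) powr (- 2 * \<gamma>) / 24"
        using n_Suc2[of i] npos[of i] npos[of "Suc i"] by (simp add: powr_minus field_simps)
    qed (use c[of i] c_Suc[of i] in auto)
    finally show ?thesis by (simp add: d_def)
  qed
  have d_Suc: "d (Suc i) \<le> d i / 2" for i
  proof -
    have "1 \<le> real (n (Suc i)) powr \<gamma>"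
      using n4[of "Suc i"] \<gamma> by (intro ge_one_powr_ge_zero) auto
    then have "real (n (Suc i)) powr \<gamma> * 1 \<le> real (n (Suc i)) powr \<gamma> * real (n (Suc i)) powr \<gamma>"
      by (intro mult_left_mono) auto
    then have "24 * real (n i) powr (2 * \<gamma>) \<le> real (n (Suc i)) powr (2 * \<gamma>)"
      using n_Suc2[of i] by (simp flip: powr_add)
    then have "2 * real (n i) powr (2 * \<gamma>) \<le> real (n (Suc i)) powr (2 * \<gamma>)"
      using powr_ge_zero[of "real (n i)" "2 * \<gamma>"] by linarith
    then have "real (n (Suc i)) powr (- 2 * \<gamma>) \<le> real (n i) powr (- 2 * \<gamma>) / 2"
      using npos[of i] npos[of "Suc i"] by (simp add: powr_minus field_simps)
    then have "d (Suc i) \<le> c i * (real (n i) powr (- 2 * \<gamma>) / 2)"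
      unfolding d_def using c[of i] by (intro mult_mono c_Suc) auto
    then show ?thesis by (simp add: d_def)
  qed
  have d_add: "d (k + i) \<le> d i * (1 / 2) ^ k" for i k
  proof (induction k)
    case (Suc k)
    with d_Suc[of "k + i"] show ?case by simp
  qed simp
  have u_tail: "norm (u (k + Suc i)) \<le> d i / 4 * (1 / 2) ^ k" for i k
    using u_Suc[of "k + i"] d_add[of k i] by simp
  have geo: "summable (\<lambda>k. d i / 4 * (1 / 2) ^ k)" for i
    by (intro summable_mult summable_geometric) simp
  have norm_summable: "summable (\<lambda>k. norm (u (k + Suc i)))" for i
    by (rule summable_comparison_test'[OF geo]) (use u_tail in auto)
  then have summable_u: "summable u"
    using summable_norm_cancel[OF norm_summable[of 0]] by (simp add: summable_Suc_iff)
  define T where "T = suminf u"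
  \<comment> \<open>Splitting at the bump \<open>u i\<close>: \<open>P i\<close> collects the
    earlier bumps and has rank at most \<open>\<sigma> i\<close>, \<open>Q i\<close> collects the
    later ones and is small in norm.\<close>
  define P where "P i = (\<Sum>k<i. u k)" for i
  define Q where "Q i = (\<Sum>k. u (k + Suc i))" for i
  define \<sigma> where "\<sigma> i = (\<Sum>k<i. A * n k)" for i
  have T_eq: "T = P i + u i + Q i" for i
    using suminf_split_initial_segment[OF summable_u, of "Suc i"]
    by (simp add: T_def P_def Q_def add.commute)
  have Q: "norm (Q i) \<le> d i / 2" for i
  proof -
    have "norm (Q i) \<le> (\<Sum>k. norm (u (k + Suc i)))"
      unfolding Q_def by (rule summable_norm[OF norm_summable])
    also have "\<dots> \<le> (\<Sum>k. d i / 4 * (1 / 2) ^ k)"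
      by (intro suminf_le u_tail norm_summable geo)
    also have "\<dots> = d i / 4 * (\<Sum>k. (1 / 2) ^ k)"
      by (rule suminf_mult) (intro summable_geometric, simp)
    also have "(\<Sum>k. (1 / 2) ^ k :: real) = 2" by (subst suminf_geometric) auto
    finally show ?thesis by simp
  qed
  have rku: "rk (A * n i) (u i)" for i using rkB by (simp add: u_def rk_scaleR)
  have rkP: "rk (\<sigma> i) (P i)" for i unfolding \<sigma>_def P_def by (intro rk_sum rku) auto
  have \<sigma>_Suc: "\<sigma> (Suc i) = \<sigma> i + A * n i" for i by (simp add: \<sigma>_def)
  have nA: "n i \<le> A * n i" for i using A by simp
  have \<sigma>_step: "2 * \<sigma> (Suc i) \<le> 4 * (A * n i)" if "2 * \<sigma> i \<le> n i" for i
  proof -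
    have "2 * (x + k) \<le> 4 * k" if "2 * x \<le> m" "m \<le> k" for x k m :: nat
      using that by presburger
    then show ?thesis unfolding \<sigma>_Suc using that nA by blast
  qed
  have \<sigma>: "2 * \<sigma> i \<le> n i" for i
  proof (induction i)
    case (Suc i)
    from order_trans[OF \<sigma>_step[OF Suc.IH] n_Suc1] show ?case .
  qed (simp add: \<sigma>_def)
  have T_ops: "T \<in> ops"
  proof -
    have "P i \<in> ops" for i using rk_ops[OF rkP] .
    moreover have "P \<longlonglongrightarrow> T"
      using summable_LIMSEQ[OF summable_u] by (simp add: P_def[abs_def] T_def)
    ultimately show ?thesis using closed_ops by (meson closed_sequentially)
  qed
  have Eu: "E m (u i) = d i * E m (B i)" for m i
    using d[of i] by (simp add: u_def E_scaleR)

  \<comment> \<open>Removing \<open>P i\<close> costs \<open>\<sigma> i\<close> in the index,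
    removing \<open>Q i\<close> costs half of the lower bound \<open>d i\<close> for the
    bump.\<close>
  have ET_ge: "d i / 2 \<le> E m T" if m: "m + \<sigma> i < n i" for i m
  proof -
    have "d i * 1 \<le> d i * E (n i - 1) (B i)" using d[of i] EB_ge[of i] by (intro mult_left_mono) auto
    also have "\<dots> = E (n i - 1) (u i)" by (simp add: Eu)
    also have "\<dots> \<le> E (m + \<sigma> i) (u i)" using m by (intro E_antimono) auto
    also have "\<dots> \<le> E (m + \<sigma> i) (T - P i) + norm (u i - (T - P i))" by (rule E_perturb)
    also have "u i - (T - P i) = - Q i" using T_eq[of i] by simp
    also have "E (m + \<sigma> i) (T - P i) \<le> E m T + E (\<sigma> i) ((- 1) *\<^sub>R P i)"
      using E_add[of m "\<sigma> i" T "(- 1) *\<^sub>R P i"] by simp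
    also have "E (\<sigma> i) ((- 1) *\<^sub>R P i) = 0" by (intro E_eq_0 rk_scaleR rkP)
    finally show ?thesis using Q[of i] by simp
  qed

  define C0 where "C0 = 6 * 2 powr \<gamma> + (4 * real A) powr \<gamma> / 2"
  have C0: "C0 > 0" by (simp add: C0_def add_pos_nonneg)
  \<comment> \<open>Of the index \<open>m\<close>, the part \<open>\<sigma> i\<close> annihilates
    \<open>P i\<close> and at least half remains for the bump, which gives the first summand of
    \<open>C0\<close>. The second absorbs the norm of \<open>Q i\<close>, as \<open>Suc m\<close> is
    at most \<open>4 * A * n i\<close> in this range.\<close>
  have ET_le: "E m T \<le> C0 * d i * (real (n i) / real (Suc m)) powr \<gamma>"
    if m: "2 * \<sigma> i \<le> m" "m < 2 * \<sigma> (Suc i)" for i m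
  proof -
    let ?x = "real (n i) / real (Suc m)"
    have "Suc m \<le> 4 * (A * n i)"
      using m(2) \<sigma>_step[OF \<sigma>[of i]] by simp
    then have "real (Suc m) \<le> real (4 * (A * n i))" by (simp only: of_nat_le_iff)
    then have "1 \<le> (4 * real A * ?x) powr \<gamma>"
      using \<gamma> by (intro ge_one_powr_ge_zero) (auto simp: field_simps)
    also have "\<dots> = (4 * real A) powr \<gamma> * ?x powr \<gamma>" by (rule powr_mult)
    finally have x1: "1 \<le> (4 * real A) powr \<gamma> * ?x powr \<gamma>" .
    have "E m T = E (\<sigma> i + (m - \<sigma> i)) (P i + (u i + Q i))"
      using m(1) by (simp add: T_eq[of i] add.assoc)
    also have "\<dots> \<le> E (\<sigma> i) (P i) + E (m - \<sigma> i) (u i + Q i)" by (rule E_add)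
    also have "\<dots> \<le> E (m - \<sigma> i) (u i) + norm (Q i)"
      using E_perturb[of "m - \<sigma> i" "u i + Q i" "u i"] by (simp add: E_eq_0[OF rkP])
    finally have 1: "E m T \<le> d i * E (m - \<sigma> i) (B i) + d i / 2"
      using Q[of i] by (simp add: Eu)
    have "real (Suc m) \<le> 2 * real (Suc (m - \<sigma> i))" using m(1) by simp
    then have "real (n i) / real (Suc (m - \<sigma> i)) \<le> 2 * ?x"
      using npos[of i] by (simp add: field_simps del: of_nat_Suc)
    then have "(real (n i) / real (Suc (m - \<sigma> i))) powr \<gamma> \<le> (2 * ?x) powr \<gamma>"
      using \<gamma> by (intro powr_mono2) auto
    also have "\<dots> = 2 powr \<gamma> * ?x powr \<gamma>" by (rule powr_mult)
    finally have "E (m - \<sigma> i) (B i) \<le> 6 * (2 powr \<gamma> * ?x powr \<gamma>)"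
      using EB_le[of "m - \<sigma> i" i] by linarith
    then have "d i * E (m - \<sigma> i) (B i) + d i / 2 * 1 \<le>
        d i * (6 * (2 powr \<gamma> * ?x powr \<gamma>)) + d i / 2 * ((4 * real A) powr \<gamma> * ?x powr \<gamma>)"
      using d[of i] x1 by (intro add_mono mult_left_mono) auto
    with 1 show ?thesis by (simp add: C0_def algebra_simps del: of_nat_Suc)
  qed

  have "T \<in> approx_space sX sY p s"
  proof -
    define g where "g m = real (Suc m) powr (s / p - 1) * E m T powr s" for m
    have g0: "g m \<ge> 0" for m by (simp add: g_def)
    define e where "e = \<gamma> * s"
    have e: "e > 0" using \<gamma> s by (simp add: e_def)
    obtain C1 where C1: "C1 > 0" "\<And>M. (\<Sum>m<M. real (Suc m) powr (e - 1)) \<le> C1 * real M powr e"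
      using sum_powr_le[OF e] by blast
    define C2 where "C2 = C0 powr s * C1 * (4 * real A) powr e"
    \<comment> \<open>All powers of \<open>n i\<close> cancel: the coefficient contributes exponent
      \<open>- 2 * e\<close>, the bump \<open>e\<close>, and the sum of powers up to
      \<open>4 * A * n i\<close> another \<open>e\<close>.\<close>
    have block: "(\<Sum>m = 2 * \<sigma> i..<2 * \<sigma> (Suc i). g m) \<le> C2 * c i powr s" for i
    proof -
      define K where "K = (C0 * c i) powr s * real (n i) powr - e"
      have "g m \<le> K * real (Suc m) powr (e - 1)" if "2 * \<sigma> i \<le> m" "m < 2 * \<sigma> (Suc i)" for m
      proof -
        have "g m \<le> real (Suc m) powr (s / p - 1) *
            (C0 * d i * (real (n i) / real (Suc m)) powr \<gamma>) powr s"
          unfolding g_def using s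
          by (intro mult_left_mono powr_mono2 ET_le[OF that]) (auto simp: E_nonneg)
        also have "(C0 * d i * (real (n i) / real (Suc m)) powr \<gamma>) powr s =
            (C0 * c i) powr s * (real (n i) powr (- 2 * e) * real (n i) powr e * real (Suc m) powr - e)"
        proof -
          have "(real (n i) / real (Suc m)) powr \<gamma> = real (n i) powr \<gamma> * real (Suc m) powr - \<gamma>"
            by (simp add: powr_divide powr_minus_divide del: of_nat_Suc)
          then show ?thesis
            using C0 c[of i] by (simp add: d_def powr_mult powr_powr e_def mult.assoc del: of_nat_Suc)
        qed
        also have "real (n i) powr (- 2 * e) * real (n i) powr e = real (n i) powr - e"
          by (simp flip: powr_add)
        also have "real (Suc m) powr (s / p - 1) *
            ((C0 * c i) powr s * (real (n i) powr - e * real (Suc m) powr - e)) =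
            K * (real (Suc m) powr (s / p - 1) * real (Suc m) powr - e)"
          by (simp add: K_def)
        also have "real (Suc m) powr (s / p - 1) * real (Suc m) powr - e = real (Suc m) powr (e - 1)"
          by (simp add: p_\<gamma> e_def algebra_simps flip: powr_add)
        finally show ?thesis .
      qed
      then have "(\<Sum>m = 2 * \<sigma> i..<2 * \<sigma> (Suc i). g m) \<le>
          (\<Sum>m = 2 * \<sigma> i..<2 * \<sigma> (Suc i). K * real (Suc m) powr (e - 1))"
        by (intro sum_mono) auto
      also have "\<dots> \<le> (\<Sum>m<4 * (A * n i). K * real (Suc m) powr (e - 1))"
      proof (rule sum_mono2)
        show "{2 * \<sigma> i..<2 * \<sigma> (Suc i)} \<subseteq> {..<4 * (A * n i)}"
          using \<sigma>_step[OF \<sigma>[of i]] by auto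
      qed (auto simp: K_def)
      also have "\<dots> = K * (\<Sum>m<4 * (A * n i). real (Suc m) powr (e - 1))" by (simp add: sum_distrib_left)
      also have "\<dots> \<le> K * (C1 * real (4 * (A * n i)) powr e)"
        by (intro mult_left_mono C1) (simp add: K_def)
      also have "\<dots> = C2 * c i powr s"
        using C0 c[of i] npos[of i] by (simp add: K_def C2_def powr_mult powr_minus field_simps)
      finally show ?thesis .
    qed
    have sums: "(\<Sum>m<2 * \<sigma> I. g m) \<le> (\<Sum>i<I. C2 * c i powr s)" for I
    proof (induction I)
      case (Suc I)
      have "(\<Sum>m<2 * \<sigma> (Suc I). g m) = (\<Sum>m<2 * \<sigma> I. g m) + (\<Sum>m = 2 * \<sigma> I..<2 * \<sigma> (Suc I). g m)"
        unfolding lessThan_atLeast0 by (rule sum.atLeastLessThan_concat[symmetric]) (auto simp: \<sigma>_Suc)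
      with Suc block[of I] show ?case by simp
    qed (simp add: \<sigma>_def)
    have cs: "c i powr s = real (Suc i) powr (- s / r)" for i
      by (simp add: c_def powr_powr)
    have "- s / r < - 1" using r rs by (simp add: field_simps)
    then have "summable (\<lambda>i. real i powr (- s / r))" by (simp add: summable_real_powr_iff)
    then have sc: "summable (\<lambda>i. C2 * c i powr s)"
      unfolding cs by (intro summable_mult) (simp only: summable_Suc_iff[of "\<lambda>i. real i powr (- s / r)"])
    have C2: "C2 > 0" using C0 C1 A by (simp add: C2_def)
    have "summable g"
    proof (rule summableI_nonneg_bounded[OF g0])
      fix M
      \<comment> \<open>The blocks exhaust all indices.\<close>
      have "M \<le> \<sigma> M"
      proof (induction M)
        case (Suc M)
        then show ?case using nA[of M] n4[of M] unfolding \<sigma>_Suc by linarith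
      qed simp
      then have "(\<Sum>m<M. g m) \<le> (\<Sum>m<2 * \<sigma> M. g m)" by (intro sum_mono2 g0) auto
      also have "\<dots> \<le> (\<Sum>i<M. C2 * c i powr s)" by (rule sums)
      also have "\<dots> \<le> (\<Sum>i. C2 * c i powr s)"
        using C2 by (intro sum_le_suminf sc) auto
      finally show "(\<Sum>m<M. g m) \<le> (\<Sum>i. C2 * c i powr s)" .
    qed
    then show ?thesis using T_ops s by (simp add: approx_space_iff g_def[abs_def])
  qed

  moreover have "T \<notin> approx_space sX sY p r"
  proof
    assume "T \<in> approx_space sX sY p r"
    define f where "f m = real (Suc m) powr (r / p - 1) * E m T powr r" for m
    have f: "summable f"
      using \<open>T \<in> approx_space sX sY p r\<close> r by (simp add: approx_space_iff f_def[abs_def])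
    have f0: "f m \<ge> 0" for m by (simp add: f_def)
    define e where "e = r / p"
    have e: "e > 0" using r p by (simp add: e_def)
    obtain k where k: "k > 0" "\<And>h. k * real h powr e \<le> (\<Sum>m = h..<2 * h. real (Suc m) powr (e - 1))"
      using sum_powr_ge by blast
    \<comment> \<open>Both \<open>2 * h i\<close> and \<open>\<sigma> i\<close> are at most half of
      \<open>n i\<close>, so \<open>ET_ge\<close> applies throughout the block from
      \<open>h i\<close> to \<open>2 * h i\<close>.\<close>
    define h where "h i = n i div 4" for i
    have h_le: "4 * h i \<le> n i" for i by (simp add: h_def)
    define k' where "k' = k * (1 / 8) powr e * (1 / 2) powr r"
    have k': "k' > 0" using k by (simp add: k'_def)
    \<comment> \<open>The powers of \<open>n i\<close> cancel again, and \<open>c i powr r\<close>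
      is the harmonic term.\<close>
    have block: "k' * (1 / real (Suc i)) \<le> (\<Sum>m = h i..<2 * h i. f m)" for i
    proof -
      have "n i \<le> 8 * h i" using n4[of i] unfolding h_def by presburger
      then have "real (n i) \<le> real (8 * h i)" by (simp only: of_nat_le_iff)
      then have "(real (n i) * (1 / 8)) powr e \<le> real (h i) powr e" using e by (intro powr_mono2) auto
      then have "k * (real (n i) * (1 / 8)) powr e * (d i * (1 / 2)) powr r \<le>
          k * real (h i) powr e * (d i * (1 / 2)) powr r"
        using k by (intro mult_right_mono mult_left_mono) auto
      also have "\<dots> \<le> (\<Sum>m = h i..<2 * h i. real (Suc m) powr (e - 1)) * (d i * (1 / 2)) powr r"
        by (intro mult_right_mono k) simp
      also have "\<dots> \<le> (\<Sum>m = h i..<2 * h i. f m)"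
        unfolding sum_distrib_right
      proof (rule sum_mono)
        fix m assume "m \<in> {h i..<2 * h i}"
        then have "m + \<sigma> i < n i" using \<sigma>[of i] h_le[of i] by simp
        from ET_ge[OF this] have "(d i * (1 / 2)) powr r \<le> E m T powr r"
          using d[of i] r by (intro powr_mono2) auto
        then show "real (Suc m) powr (e - 1) * (d i * (1 / 2)) powr r \<le> f m"
          by (simp add: f_def e_def mult_left_mono del: of_nat_Suc)
      qed
      also have "k * (real (n i) * (1 / 8)) powr e * (d i * (1 / 2)) powr r =
          k' * (real (n i) powr e * d i powr r)"
        by (simp only: powr_mult k'_def mult.assoc mult.commute mult.left_commute)
      also have "d i powr r = real (Suc i) powr - 1 * real (n i) powr - e"
        using r by (simp add: d_def c_def powr_mult powr_powr e_def p_\<gamma> mult.commute del: of_nat_Suc)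
      also have "real (n i) powr e * (real (Suc i) powr - 1 * real (n i) powr - e) = 1 / real (Suc i)"
        using npos[of i] by (simp add: powr_minus field_simps del: of_nat_Suc)
      finally show ?thesis .
    qed
    have sums: "(\<Sum>i<I. k' * (1 / real (Suc i))) \<le> (\<Sum>m<h I. f m)" for I
    proof (induction I)
      case 0
      then show ?case by (simp add: sum_nonneg f0)
    next
      case (Suc I)
      \<comment> \<open>The next block starts after the present one has ended, so the blocks are
        disjoint and their sums add up.\<close>
      have "n I \<le> h (Suc I)"
        using order_trans[OF mult_le_mono2[OF nA[of I], of 4] n_Suc1[of I]]
        by (simp add: h_def less_eq_div_iff_mult_less_eq mult.commute)
      moreover have "2 * h I \<le> n I" using h_le[of I] by simp
      ultimately have "2 * h I \<le> h (Suc I)" by simp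
      then have "(\<Sum>m<2 * h I. f m) \<le> (\<Sum>m<h (Suc I). f m)" by (intro sum_mono2 f0) auto
      moreover have "(\<Sum>m<2 * h I. f m) = (\<Sum>m<h I. f m) + (\<Sum>m = h I..<2 * h I. f m)"
        unfolding lessThan_atLeast0 by (rule sum.atLeastLessThan_concat[symmetric]) auto
      ultimately show ?case using Suc block[of I] by simp
    qed
    have "summable (\<lambda>i. k' * (1 / real (Suc i)))"
    proof (rule summableI_nonneg_bounded)
      fix I
      have "(\<Sum>m<h I. f m) \<le> suminf f" by (intro sum_le_suminf f f0) auto
      with sums show "(\<Sum>i<I. k' * (1 / real (Suc i))) \<le> suminf f" by (rule order_trans)
    qed (use k' in simp)
    then have "summable (\<lambda>i. 1 / real (Suc i))"
      using k' summable_cmult_iff[of k' "\<lambda>i. 1 / real (Suc i)"] by simp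
    then have "summable (\<lambda>i. 1 / real i)" by (simp only: summable_Suc_iff[of "\<lambda>i. 1 / real i"])
    then show False
      using summable_real_powr_iff[of "- 1"] by (simp add: powr_minus inverse_eq_divide)
  qed
  ultimately show ?thesis by blast
qed

section \<open>Separation of the spaces\<close>

lemma approx_space_distinct_snd:
  assumes "p > 0" "r > 0" "s > 0" "r \<noteq> s"
  shows "approx_space sX sY p r \<noteq> approx_space sX sY p s"
  using approx_space_not_subset[of p r s] approx_space_not_subset[of p s r] assms
  by (cases r s rule: linorder_cases) auto

text \<open>If the two spaces agreed, then for \<open>t\<close> between \<open>p\<close> and
  \<open>p'\<close> the space with parameters \<open>t\<close>, 2 would lie in the one with
  parameters \<open>t\<close>, 1, contrary to \<open>approx_space_not_subset\<close>.\<close>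

lemma approx_space_distinct_fst:
  assumes "0 < p" "p < p'" "q > 0" "q' > 0"
  shows "approx_space sX sY p q \<noteq> approx_space sX sY p' q'"
proof
  assume eq: "approx_space sX sY p q = approx_space sX sY p' q'"
  obtain t where t: "p < t" "t < p'" using dense assms(2) by blast
  have "approx_space sX sY t 2 \<subseteq> approx_space sX sY p' q'"
    using assms t by (intro approx_space_mono) auto
  also have "\<dots> \<subseteq> approx_space sX sY t 1"
    unfolding eq[symmetric] using assms t by (intro approx_space_mono) auto
  finally show False using approx_space_not_subset[of t 1 2] assms t by simp
qed

end

theorem theorem3p1:
  fixes sX :: "'k::real_or_complex \<Rightarrow> 'a::banach \<Rightarrow> 'a"
    and sY :: "'k \<Rightarrow> 'b::banach \<Rightarrow> 'b"
  assumes "normed_space_over sX" and "normed_space_over sY"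
    and "\<not> fin_dim sX UNIV" and "\<not> fin_dim sY UNIV"
  shows "(\<forall>p>0. \<forall>p'>0. p \<noteq> p' \<longrightarrow>
            (\<forall>q1>0. \<forall>q2>0. approx_space sX sY p q1 \<noteq> approx_space sX sY p' q2)) \<and>
         (\<forall>p>0. (\<forall>r>0. \<forall>s>0. approx_space sX sY p r = approx_space sX sY p s) \<or>
                (\<forall>r>0. \<forall>s>0. r \<noteq> s \<longrightarrow> approx_space sX sY p r \<noteq> approx_space sX sY p s))"
proof -
  interpret operator_pair sX sY
    using assms by (simp add: operator_pair_def operator_pair_axioms_def)
  have "approx_space sX sY p q1 \<noteq> approx_space sX sY p' q2"
    if "p > 0" "p' > 0" "p \<noteq> p'" "q1 > 0" "q2 > 0" for p p' q1 q2
    using approx_space_distinct_fst[of p p' q1 q2] approx_space_distinct_fst[of p' p q2 q1] that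
    by (cases p p' rule: linorder_cases) auto
  moreover have "approx_space sX sY p r \<noteq> approx_space sX sY p s"
    if "p > 0" "r > 0" "s > 0" "r \<noteq> s" for p r s
    using approx_space_distinct_snd that by blast
  ultimately show ?thesis by blast
qed

end
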